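(* For every $n\in\mathbb N$ and positive integers $b_1,b_2$, let $$\mathcal N_2(b_1,b_2;n)=\#\{(x_1,x_2,x_3,x_4)\in\mathbb Z^4:\ b_1(x_1^2+x_1x_2+x_2^2)+b_2(x_3^2+x_3x_4+x_4^2)=n\}.$$ Then for every $n\in\mathbb N$: \begin{align*} \mathcal N_2(1,2;n)&=6\sigma(n)-12\sigma(n/2)+18\sigma(n/3)-36\sigma(n/6),\\ \mathcal N_2(1,4;n)&=6\sigma(n)-18\sigma(n/2)-18\sigma(n/3)+24\sigma(n/4)+54\sigma(n/6)-72\sigma(n/12),\\ \mathcal N_2(1,8;n)&=\tfrac32\sigma(n)-\tfrac92\sigma(n/2)+\tfrac92\sigma(n/3)+9\sigma(n/4)-\tfrac{27}{2}\sigma(n/6)-12\sigma(n/8)\\ &\quad+27\sigma(n/12)-36\sigma(n/24)+\tfrac92\tau_{2,24}(n),\\ \mathcal N_2(1,16;n)&=\tfrac32\sigma(n)-\tfrac92\sigma(n/2)-\tfrac92\sigma(n/3)+9\sigma(n/4)+\tfrac{27}{2}\sigma(n/6)-18\sigma(n/8)\\ &\quad-27\sigma(n/12)+24\sigma(n/16)+54\sigma(n/24)-72\sigma(n/48)+\tfrac92\tau_{2,48}(n). \end{align*}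
   Context: $\sigma(m)$ denotes the sum of the positive divisors of $m$ for $m\in\mathbb N$, and $\sigma(x)=0$ if $x$ is not a positive integer (so $\sigma(n/d)=0$ when $d\nmid n$). Let $q=e^{2\pi i z}$ with $\mathrm{Im}(z)>0$ and $\eta(z)=q^{1/24}\prod_{m\ge1}(1-q^m)$ be the Dedekind eta function. The integers $\tau_{2,24}(n)$ and $\tau_{2,48}(n)$ are defined by the $q$-expansions $$\eta(2z)\eta(4z)\eta(6z)\eta(12z)=\sum_{n\ge1}\tau_{2,24}(n)q^n,\qquad \frac{\eta(4z)^4\eta(12z)^4}{\eta(2z)\eta(6z)\eta(8z)\eta(24z)}=\sum_{n\ge1}\tau_{2,48}(n)q^n.$$ *)

theory Defs
  imports "HOL-Analysis.Analysis"
begin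

definition divisor_sigma :: "real \<Rightarrow> real" where
  "divisor_sigma x =
     (if \<exists>m::nat. m > 0 \<and> x = real m then \<Sum>d | d dvd nat \<lfloor>x\<rfloor>. real d else 0)"

definition to_q :: "complex \<Rightarrow> complex" where
  "to_q z = exp (2 * complex_of_real pi * \<i> * z)"

(* The branch of q^(1/24) is the standard one, exp (2 pi i z / 24). *)
definition dedekind_eta :: "complex \<Rightarrow> complex" where
  "dedekind_eta z =
     exp (2 * complex_of_real pi * \<i> * z / 24) * (\<Prod>m. 1 - to_q z ^ Suc m)"

(* f(z) = sum_{n >= 1} t(n) q^n on the upper half-plane. The series in the definition starts
   at index 0, so the condition t 0 = 0 is what makes it start at 1. *)
definition has_q_expansion :: "(complex \<Rightarrow> complex) \<Rightarrow> (nat \<Rightarrow> int) \<Rightarrow> bool" where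
  "has_q_expansion f t \<longleftrightarrow>
     t 0 = 0 \<and> (\<forall>z. Im z > 0 \<longrightarrow> (\<lambda>n. of_int (t n) * to_q z ^ n) sums f z)"

definition tau_2_24 :: "nat \<Rightarrow> int" where
  "tau_2_24 = (THE t. has_q_expansion
     (\<lambda>z. dedekind_eta (2 * z) * dedekind_eta (4 * z) *
          dedekind_eta (6 * z) * dedekind_eta (12 * z)) t)"

definition tau_2_48 :: "nat \<Rightarrow> int" where
  "tau_2_48 = (THE t. has_q_expansion
     (\<lambda>z. (dedekind_eta (4 * z) ^ 4 * dedekind_eta (12 * z) ^ 4) /
          (dedekind_eta (2 * z) * dedekind_eta (6 * z) *
           dedekind_eta (8 * z) * dedekind_eta (24 * z))) t)"

definition N2 :: "nat \<Rightarrow> nat \<Rightarrow> nat \<Rightarrow> nat" where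
  "N2 b\<^sub>1 b\<^sub>2 n = card {(x\<^sub>1 :: int, x\<^sub>2 :: int, x\<^sub>3 :: int, x\<^sub>4 :: int).
     int b\<^sub>1 * (x\<^sub>1\<^sup>2 + x\<^sub>1 * x\<^sub>2 + x\<^sub>2\<^sup>2) + int b\<^sub>2 * (x\<^sub>3\<^sup>2 + x\<^sub>3 * x\<^sub>4 + x\<^sub>4\<^sup>2) = int n}"

end

theory Submission
  imports Defs "HOL-Computational_Algebra.Formal_Laurent_Series"
begin

text \<open>
  Let \<open>a(q)\<close> be the theta series of \<open>x\<^sup>2 + x y + y\<^sup>2\<close>; the theorem is about
  \<open>a(q) a(q\<^sup>k)\<close> for \<open>k = 2, 4, 8, 16\<close>. Put \<open>X = q \<psi>(q\<^sup>2) \<psi>(q\<^sup>6)\<close>. Splitting the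
  lattice modulo 2 gives \<open>a(q) = a(q\<^sup>4) + 6 X\<close> and \<open>\<phi>(q) \<phi>(q\<^sup>3) = a(q\<^sup>4) + 2 X\<close>, and
  \<open>\<phi>(q) \<phi>(-q) = \<phi>(-q\<^sup>2)\<^sup>2\<close> turns this into a quadratic relation between \<open>a(q)\<close>, \<open>a(q\<^sup>2)\<close>,
  \<open>a(q\<^sup>4)\<close>, \<open>a(q\<^sup>8)\<close> which determines \<open>a\<close> from its first two coefficients.

  Let \<open>L = 1 + 6 \<Sum> (\<Sum>\<^bsub>d|n\<^esub> \<chi>(d)) q\<^sup>n\<close> with \<open>\<chi>\<close> the nontrivial character modulo 3. Liouville's
  elementary identity evaluates \<open>L(q)\<^sup>2\<close> and \<open>(L(q) + 2 L(q\<^sup>2))\<^sup>2\<close>, hence \<open>L(q) L(q\<^sup>2)\<close>, as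
  combinations of \<open>\<Sum> \<sigma>(n) q\<^sup>n\<close> at powers of \<open>q\<close>. Comparing even parts, \<open>L\<close> satisfies the same
  quadratic relation, so \<open>a = L\<close>, and the relation itself evaluates \<open>a(q) a(q\<^sup>4)\<close>.

  By Gauss' product formulas for \<open>\<phi>(-q)\<close> and \<open>\<psi>(q)\<close> the two eta quotients are
  \<open>X \<phi>(-q\<^sup>2) \<phi>(-q\<^sup>6)\<close> and \<open>X \<phi>(-q\<^sup>4) \<phi>(-q\<^bsup>12\<^esup>)\<close>, that is, \<open>1/18\<close> times
  \<open>(a(q) - a(q\<^sup>4)) (4 a(q\<^sup>8) - a(q\<^sup>2))\<close> and \<open>(a(q) - a(q\<^sup>4)) (4 a(q\<^bsup>16\<^esup>) - a(q\<^sup>4))\<close>;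
  expanding these reduces \<open>k = 8, 16\<close> to the previous cases.
\<close>

unbundle no vec_syntax

section \<open>Power series counting the points of a fibre\<close>

abbreviation dilate :: "int fps \<Rightarrow> nat \<Rightarrow> int fps" where
  "dilate f k \<equiv> f oo fps_X ^ k"

lemma dilate_nth:
  "k > 0 \<Longrightarrow> dilate f k $ n = (if k dvd n then f $ (n div k) else 0)"
  by (simp add: fps_nth_compose_X_power)

lemma dilate_dilate:
  assumes "j > 0" "k > 0"
  shows "dilate (dilate f j) k = dilate f (j * k)"
proof (rule fps_ext)
  fix n
  show "dilate (dilate f j) k $ n = dilate f (j * k) $ n"
    using assms by (auto simp: dilate_nth div_mult2_eq mult.commute[of j k] dvd_div_iff_mult
      elim: dvdE)
qed

lemma dilate_mult: "k > 0 \<Longrightarrow> dilate (f * g) k = dilate f k * dilate g k"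
  by (simp add: fps_compose_mult_distrib)

lemma dilate_numeral: "k > 0 \<Longrightarrow> dilate (numeral c) k = numeral c"
  by (simp add: fps_numeral_fps_const)

lemma numeral_mult_fps_nth: "(numeral c * f) $ n = numeral c * (f :: int fps) $ n"
  by (simp add: fps_numeral_fps_const)

lemmas dilate_simps = dilate_mult dilate_dilate dilate_numeral
  fps_compose_add_distrib fps_compose_sub_distrib fps_compose_1

text \<open>This makes \<open>count_series\<close> the true generating function, the sum of
  q^(\<open>f x\<close>) over \<open>S\<close>: negative values would be lost, and
  \<open>card\<close> turns an infinite fibre into 0.\<close>

definition finite_fibres :: "'a set \<Rightarrow> ('a \<Rightarrow> int) \<Rightarrow> bool" where
  "finite_fibres S f \<longleftrightarrow> (\<forall>x\<in>S. 0 \<le> f x) \<and> (\<forall>n::nat. finite {x\<in>S. f x = int n})"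

definition count_series :: "'a set \<Rightarrow> ('a \<Rightarrow> int) \<Rightarrow> int fps" where
  "count_series S f = Abs_fps (\<lambda>n. int (card {x\<in>S. f x = int n}))"

lemma finite_fibres_subset: "finite_fibres S f \<Longrightarrow> T \<subseteq> S \<Longrightarrow> finite_fibres T f"
  unfolding finite_fibres_def
  by (auto elim!: rev_finite_subset)

lemma finite_fibres_scale:
  assumes "finite_fibres S f" "k > 0"
  shows "finite_fibres S (\<lambda>x. int k * f x)"
  unfolding finite_fibres_def
proof (intro conjI ballI allI)
  fix n :: nat
  have "{x\<in>S. int k * f x = int n} \<subseteq> {x\<in>S. f x = int (n div k)}"
  proof safe
    fix x
    assume "int k * f x = int n"
    then show "f x = int (n div k)"
      using assms(2) by (simp add: zdiv_int flip: \<open>int k * f x = int n\<close>)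
  qed
  then show "finite {x\<in>S. int k * f x = int n}"
    using assms(1) finite_subset unfolding finite_fibres_def by blast
qed (use assms in \<open>auto simp: finite_fibres_def\<close>)

text \<open>Both summands are nonnegative, so a total of \<open>n\<close> forces \<open>f x\<close>
  into 0, ..., n, and the fibre splits into finitely many rectangles; counting them gives the Cauchy
  product.\<close>

lemma fibre_Times:
  assumes "finite_fibres S f" "finite_fibres T g"
  shows "{p \<in> S \<times> T. (case p of (x, y) \<Rightarrow> f x + g y) = int n} =
         (\<Union>i\<in>{0..n}. {x\<in>S. f x = int i} \<times> {y\<in>T. g y = int (n - i)})"
proof -
  have "\<exists>i\<le>n. f x = int i \<and> g y = int (n - i)" if "x \<in> S" "y \<in> T" "f x + g y = int n" for x y
  proof (intro exI[of _ "nat (f x)"])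
    have "0 \<le> f x" "0 \<le> g y" using assms that by (auto simp: finite_fibres_def)
    then show "nat (f x) \<le> n \<and> f x = int (nat (f x)) \<and> g y = int (n - nat (f x))"
      using that(3) by auto
  qed
  then show ?thesis by force
qed

lemma finite_fibres_Times:
  assumes "finite_fibres S f" "finite_fibres T g"
  shows "finite_fibres (S \<times> T) (\<lambda>(x, y). f x + g y)"
  unfolding finite_fibres_def
proof (intro conjI ballI allI)
  fix n :: nat
  show "finite {p \<in> S \<times> T. (case p of (x, y) \<Rightarrow> f x + g y) = int n}"
    unfolding fibre_Times[OF assms] using assms
    by (intro finite_UN_I finite_cartesian_product) (simp_all only: finite_fibres_def
        finite_atLeastAtMost)
qed (use assms in \<open>auto simp: finite_fibres_def\<close>)

lemma count_series_mult:
  assumes "finite_fibres S f" "finite_fibres T g"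
  shows "count_series S f * count_series T g = count_series (S \<times> T) (\<lambda>(x, y). f x + g y)"
proof (rule fps_ext)
  fix n
  have "card {p \<in> S \<times> T. (case p of (x, y) \<Rightarrow> f x + g y) = int n}
      = (\<Sum>i\<in>{0..n}. card ({x\<in>S. f x = int i} \<times> {y\<in>T. g y = int (n - i)}))"
    unfolding fibre_Times[OF assms]
    using assms by (intro card_UN_disjoint ballI finite_cartesian_product)
      (auto simp only: finite_fibres_def)
  then show "(count_series S f * count_series T g) $ n
      = count_series (S \<times> T) (\<lambda>(x, y). f x + g y) $ n"
    by (simp add: count_series_def fps_mult_nth card_cartesian_product)
qed

lemma count_series_Un:
  assumes "finite_fibres (S \<union> T) f" "S \<inter> T = {}"
  shows "count_series (S \<union> T) f = count_series S f + count_series T f"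
proof (rule fps_ext)
  fix n
  have eq: "{x \<in> S \<union> T. f x = int n} = {x \<in> S. f x = int n} \<union> {x \<in> T. f x = int n}" by auto
  have fin: "finite {x \<in> S \<union> T. f x = int n}"
    using assms(1) by (simp add: finite_fibres_def)
  have "card {x \<in> S \<union> T. f x = int n} = card {x \<in> S. f x = int n} + card {x \<in> T. f x = int n}"
    unfolding eq using fin assms(2) unfolding eq by (intro card_Un_disjoint) auto
  then show "count_series (S \<union> T) f $ n = (count_series S f + count_series T f) $ n"
    by (simp add: count_series_def)
qed

lemma count_series_bij:
  assumes "\<And>x. x \<in> S \<Longrightarrow> h x \<in> T" "\<And>y. y \<in> T \<Longrightarrow> k y \<in> S"
    and "\<And>x. x \<in> S \<Longrightarrow> k (h x) = x" "\<And>y. y \<in> T \<Longrightarrow> h (k y) = y"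
    and "\<And>x. x \<in> S \<Longrightarrow> g (h x) = f x"
  shows "count_series S f = count_series T g"
proof (rule fps_ext)
  fix n
  have "bij_betw h {x\<in>S. f x = int n} {y\<in>T. g y = int n}"
    using assms by (intro bij_betw_byWitness[where f' = k]) (auto, metis)
  then show "count_series S f $ n = count_series T g $ n"
    by (simp add: count_series_def bij_betw_same_card)
qed

lemma dilate_count_series:
  assumes "k > 0"
  shows "dilate (count_series S f) k = count_series S (\<lambda>x. int k * f x)"
proof (rule fps_ext)
  fix n
  have "{x \<in> S. int k * f x = int n} = (if k dvd n then {x \<in> S. f x = int (n div k)} else {})"
  proof (cases "k dvd n")
    case False
    then show ?thesis by (auto simp flip: int_dvd_int_iff) (metis dvd_triv_left)
  qed (use assms in \<open>auto elim!: dvdE\<close>)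
  then show "dilate (count_series S f) k $ n = count_series S (\<lambda>x. int k * f x) $ n"
    using assms by (simp add: dilate_nth count_series_def)
qed

lemma fps_X_mult_count_series:
  assumes "\<And>x. x \<in> S \<Longrightarrow> 0 \<le> f x"
  shows "fps_X * count_series S f = count_series S (\<lambda>x. f x + 1)"
proof (rule fps_ext)
  fix n
  \<comment> \<open>For \<open>n = 0\<close> the fibre is empty because the value -1 is excluded;
    this matches the zero constant coefficient of a multiple of \<open>fps_X\<close>.\<close>
  have "{x \<in> S. f x + 1 = int n} = (if n = 0 then {} else {x \<in> S. f x = int (n - 1)})"
    using assms by force
  then show "(fps_X * count_series S f) $ n = count_series S (\<lambda>x. f x + 1) $ n"
    by (simp add: count_series_def)
qed

section \<open>Theta series\<close>

definition eisenstein_form :: "int \<times> int \<Rightarrow> int" where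
  "eisenstein_form = (\<lambda>(x, y). x\<^sup>2 + x * y + y\<^sup>2)"

text \<open>The cubic theta function a(q) of the Borweins; the next definitions are Ramanujan's
  phi(q), phi(-q) and psi(q).\<close>

definition borwein_a :: "int fps" where
  "borwein_a = count_series UNIV eisenstein_form"

definition theta_phi :: "int fps" where
  "theta_phi = count_series UNIV (\<lambda>x::int. x\<^sup>2)"

definition theta_phi_minus :: "int fps" where
  "theta_phi_minus = theta_phi oo (- fps_X)"

definition theta_psi :: "int fps" where
  "theta_psi = count_series {0..} (\<lambda>x::int. x * (x + 1) div 2)"

definition theta_X :: "int fps" where
  "theta_X = fps_X * (dilate theta_psi 2 * dilate theta_psi 6)"

lemma abs_le_square_int: "\<bar>z\<bar> \<le> (z::int)\<^sup>2"
proof (cases "z = 0")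
  case False
  then have "\<bar>z\<bar> * 1 \<le> \<bar>z\<bar> * \<bar>z\<bar>" by (intro mult_left_mono) auto
  then show ?thesis by (simp add: power2_eq_square)
qed simp

lemma finite_fibres_eisenstein_form: "finite_fibres S eisenstein_form"
proof -
  have *: "0 \<le> x\<^sup>2 + x * y + y\<^sup>2" "\<bar>x\<bar> \<le> 2 * (x\<^sup>2 + x * y + y\<^sup>2)"
    "\<bar>y\<bar> \<le> 2 * (x\<^sup>2 + x * y + y\<^sup>2)" for x y :: int
  proof -
    \<comment> \<open>Twice the form is a sum of three squares, which gives nonnegativity and bounds
      both coordinates.\<close>
    have eq: "2 * (x\<^sup>2 + x * y + y\<^sup>2) = x\<^sup>2 + y\<^sup>2 + (x + y)\<^sup>2"
      by (simp add: power2_eq_square algebra_simps)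
    show "0 \<le> x\<^sup>2 + x * y + y\<^sup>2" using eq by (smt (verit) zero_le_power2)
    show "\<bar>x\<bar> \<le> 2 * (x\<^sup>2 + x * y + y\<^sup>2)" "\<bar>y\<bar> \<le> 2 * (x\<^sup>2 + x * y + y\<^sup>2)"
      unfolding eq using abs_le_square_int[of x] abs_le_square_int[of y] zero_le_power2[of "x + y"]
        zero_le_power2[of x] zero_le_power2[of y] by linarith+
  qed
  have "finite {p \<in> S. eisenstein_form p = int n}" for n
  proof (rule finite_subset)
    show "{p \<in> S. eisenstein_form p = int n} \<subseteq> {-2 * int n..2 * int n} \<times> {-2 * int n..2 * int n}"
    proof safe
      fix x y
      assume "eisenstein_form (x, y) = int n"
      then show "x \<in> {-2 * int n..2 * int n}" "y \<in> {-2 * int n..2 * int n}"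
        using *(2,3)[where x = x and y = y] by (auto simp: eisenstein_form_def)
    qed
  qed simp
  then show ?thesis
    using *(1) by (auto simp: finite_fibres_def eisenstein_form_def)
qed

lemma finite_fibres_square: "finite_fibres S (\<lambda>x::int. x\<^sup>2)"
proof -
  have "finite {x \<in> S. x\<^sup>2 = int n}" for n
  proof (rule finite_subset)
    show "{x \<in> S. x\<^sup>2 = int n} \<subseteq> {- int n..int n}"
    proof safe
      fix x :: int
      assume "x\<^sup>2 = int n"
      then show "x \<in> {- int n..int n}" using abs_le_square_int[of x] by auto
    qed
  qed simp
  then show ?thesis by (auto simp: finite_fibres_def)
qed

lemma finite_fibres_triangular: "finite_fibres S (\<lambda>x::int. x * (x + 1) div 2)"
proof -
  have *: "x * (x + 1) \<ge> 2 * \<bar>x + 1\<bar> - 2" "x * (x + 1) \<ge> 0" for x :: int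
  proof -
    \<comment> \<open>Products of two consecutive integers are nonnegative; the first serves the
      case x + 1 \<ge> 0 of the bound, the last the case x + 1 < 0.\<close>
    have "0 \<le> x * (x - 1)"
      by (cases "x \<ge> 1") (auto intro!: mult_nonneg_nonneg mult_nonpos_nonpos)
    moreover have "0 \<le> x * (x + 1)"
      by (cases "x \<ge> 0") (auto intro!: mult_nonneg_nonneg mult_nonpos_nonpos)
    moreover have "0 \<le> (x + 1) * (x + 2)"
      by (cases "x \<ge> -1") (auto intro!: mult_nonneg_nonneg mult_nonpos_nonpos)
    ultimately show "x * (x + 1) \<ge> 2 * \<bar>x + 1\<bar> - 2" "x * (x + 1) \<ge> 0"
      by (auto simp: algebra_simps abs_if)
  qed
  have "finite {x \<in> S. x * (x + 1) div 2 = int n}" for n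
  proof (rule finite_subset)
    show "{x \<in> S. x * (x + 1) div 2 = int n} \<subseteq> {- int n - 4..int n + 4}"
    proof safe
      fix x :: int
      assume "x * (x + 1) div 2 = int n"
      then have "x * (x + 1) \<le> 2 * int n + 1" by linarith
      then have "2 * \<bar>x + 1\<bar> \<le> 2 * int n + 3" using *(1)[of x] by linarith
      then show "x \<in> {- int n - 4..int n + 4}"
        unfolding atLeastAtMost_iff by presburger
    qed
  qed simp
  then show ?thesis using *(2) by (auto simp: finite_fibres_def pos_imp_zdiv_nonneg_iff)
qed

text \<open>The reflection x -> -1 - x preserves x (x + 1) and exchanges negative and nonnegative
  integers. Summing over all integers makes linear substitutions possible.\<close>

lemma two_theta_psi: "2 * theta_psi = count_series UNIV (\<lambda>x::int. x * (x + 1) div 2)"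
proof -
  have "count_series UNIV (\<lambda>x::int. x * (x + 1) div 2)
      = count_series ({0..} \<union> {..<0}) (\<lambda>x::int. x * (x + 1) div 2)"
    by (rule arg_cong[of _ _ "\<lambda>S. count_series S _"]) auto
  also have "\<dots> = theta_psi + count_series {..<0} (\<lambda>x::int. x * (x + 1) div 2)"
    by (subst count_series_Un) (auto simp: finite_fibres_triangular theta_psi_def)
  also have "count_series {..<0} (\<lambda>x::int. x * (x + 1) div 2) = theta_psi"
    unfolding theta_psi_def
    by (rule count_series_bij[where h = "\<lambda>x. -1 - x" and k = "\<lambda>x. -1 - x"])
       (auto simp: algebra_simps)
  finally show ?thesis by simp
qed

text \<open>Completing the square: with y = 2 v and u = x + v the form becomes u^2 + 3 v^2.\<close>

lemma theta_phi_mult_eq: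
  "theta_phi * dilate theta_phi 3 = count_series {(x, y). even y} eisenstein_form"
proof -
  have "theta_phi * dilate theta_phi 3
      = count_series (UNIV \<times> UNIV) (\<lambda>(x, y). x\<^sup>2 + int 3 * y\<^sup>2)"
    unfolding theta_phi_def
    by (simp only: dilate_count_series zero_less_numeral)
       (intro count_series_mult finite_fibres_scale finite_fibres_square zero_less_numeral)
  also have "\<dots> = count_series {(x, y). even y} eisenstein_form"
    by (rule count_series_bij[where h = "\<lambda>(u, v). (u - v, 2 * v)"
          and k = "\<lambda>(x, y). (x + y div 2, y div 2)"])
       (auto simp: eisenstein_form_def power2_eq_square algebra_simps)
  finally show ?thesis .
qed

text \<open>With y = 2 v + 1 and u = x + v the form becomes u (u + 1) + 3 v (v + 1) + 1, that is, 2
  T(u) + 6 T(v) + 1 for triangular numbers T. Letting u and v run over all integers doubles each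
  psi, whence the 4.\<close>

lemma theta_X_eq: "4 * theta_X = count_series {(x, y). odd y} eisenstein_form"
proof -
  let ?t = "\<lambda>x::int. x * (x + 1) div 2"
  have nonneg: "0 \<le> ?t x" for x
    using finite_fibres_triangular[of UNIV] by (auto simp: finite_fibres_def)
  have "4 * theta_X = fps_X * (dilate (2 * theta_psi) 2 * dilate (2 * theta_psi) 6)"
    by (simp add: theta_X_def dilate_simps)
  also have "dilate (2 * theta_psi) 2 * dilate (2 * theta_psi) 6
      = count_series (UNIV \<times> UNIV) (\<lambda>(x, y). int 2 * ?t x + int 6 * ?t y)"
    unfolding two_theta_psi
    by (simp only: dilate_count_series zero_less_numeral)
       (intro count_series_mult finite_fibres_scale finite_fibres_triangular zero_less_numeral)
  also have "fps_X * \<dots> = count_series (UNIV \<times> UNIV)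
      (\<lambda>p. (case p of (x, y) \<Rightarrow> int 2 * ?t x + int 6 * ?t y) + 1)"
    using nonneg by (intro fps_X_mult_count_series) auto
  also have "\<dots> = count_series {(x, y). odd y} eisenstein_form"
  proof (rule count_series_bij[where h = "\<lambda>(u, v). (u - v, 2 * v + 1)"
          and k = "\<lambda>(x, y). (x + y div 2, y div 2)"], goal_cases)
    case (5 p)
    obtain u v where p: "p = (u, v)" by force
    have "2 * ?t u = u * (u + 1)" "2 * ?t v = v * (v + 1)" by auto
    then have "int 2 * ?t u + int 6 * ?t v = u * (u + 1) + 3 * (v * (v + 1))" by simp
    then show ?case
      by (simp add: p eisenstein_form_def power2_eq_square algebra_simps)
  qed auto
  finally show ?thesis .
qed

text \<open>The three nonzero classes of \<open>\<int>\<^sup>2\<close> modulo 2 are permuted by the isometry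
  \<open>(x, y) \<mapsto> (- y, x + y)\<close> of order 6, so they contribute equally.\<close>

lemma borwein_a_dissection:
  "borwein_a = dilate borwein_a 4 + 6 * theta_X"
  "theta_phi * dilate theta_phi 3 = dilate borwein_a 4 + 2 * theta_X"
proof -
  let ?c = "\<lambda>S. count_series S eisenstein_form"
  define C1 C2 C3 where "C1 = ?c {(x, y). even x \<and> odd y}" and "C2 = ?c {(x, y). odd x \<and> odd y}"
    and "C3 = ?c {(x, y). odd x \<and> even y}"
  have "C1 = C2" unfolding C1_def C2_def
    by (rule count_series_bij[where h = "\<lambda>(x, y). (- y, x + y)" and k = "\<lambda>(x, y). (x + y, - x)"])
       (auto simp: eisenstein_form_def power2_eq_square algebra_simps)
  moreover have "C2 = C3" unfolding C2_def C3_def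
    by (rule count_series_bij[where h = "\<lambda>(x, y). (- y, x + y)" and k = "\<lambda>(x, y). (x + y, - x)"])
       (auto simp: eisenstein_form_def power2_eq_square algebra_simps)
  moreover have "?c ({(x, y). even x \<and> odd y} \<union> {(x, y). odd x \<and> odd y}) = C1 + C2"
    unfolding C1_def C2_def by (rule count_series_Un) (auto simp: finite_fibres_eisenstein_form)
  moreover have "{(x, y). even x \<and> odd y} \<union> {(x, y). odd x \<and> odd y} = {(x::int, y::int). odd y}"
    by auto
  ultimately have "4 * theta_X = 2 * C3" "C1 = C3" "C2 = C3" by (simp_all add: theta_X_eq)
  have "2 * (2 * theta_X) = 2 * C3" using \<open>4 * theta_X = 2 * C3\<close>
      by (simp add: mult.assoc[symmetric])
  then have C3: "2 * theta_X = C3" by (metis mult_cancel_left zero_neq_numeral)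
  have "dilate borwein_a 4 = count_series UNIV (\<lambda>p. int 4 * eisenstein_form p)"
    by (simp only: dilate_count_series zero_less_numeral borwein_a_def)
  also have "\<dots> = ?c {(x, y). even x \<and> even y}"
    by (rule count_series_bij[where h = "\<lambda>(x, y). (2 * x, 2 * y)" and k
        = "\<lambda>(x, y). (x div 2, y div 2)"])
       (auto simp: eisenstein_form_def power2_eq_square algebra_simps)
  finally have a4: "dilate borwein_a 4 = ?c {(x, y). even x \<and> even y}" .
  have "?c ({(x, y). even x \<and> even y} \<union> {(x, y). odd x \<and> even y}) = dilate borwein_a 4 + C3"
    unfolding a4 C3_def by (rule count_series_Un) (auto simp: finite_fibres_eisenstein_form)
  moreover have ev: "{(x, y). even x \<and> even y} \<union> {(x, y). odd x \<and> even y}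
      = {(x::int, y::int). even y}"
    by auto
  ultimately show 2: "theta_phi * dilate theta_phi 3 = dilate borwein_a 4 + 2 * theta_X"
    by (simp add: theta_phi_mult_eq C3)
  have "?c ({(x, y). even y} \<union> {(x, y). odd y})
      = ?c {(x, y). even y} + ?c {(x, y). odd y}"
    by (rule count_series_Un) (auto simp: finite_fibres_eisenstein_form)
  moreover have "{(x, y). even y} \<union> {(x, y). odd y} = (UNIV :: (int \<times> int) set)"
    by auto
  ultimately have "borwein_a = theta_phi * dilate theta_phi 3 + 4 * theta_X"
    by (simp add: borwein_a_def theta_phi_mult_eq theta_X_eq)
  also have "\<dots> = dilate borwein_a 4 + 6 * theta_X" unfolding 2 by simp
  finally show "borwein_a = dilate borwein_a 4 + 6 * theta_X" .
qed

lemma fps_compose_uminus_X_nth: "(f oo (- fps_X)) $ n = (- 1) ^ n * (f :: int fps) $ n"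
  by (simp add: fps_compose_uminus')

text \<open>Write phi(q) = A + O with A = phi(q^4) from even and O from odd integers, so phi(-q) = A
  - O. Rotating pairs of equal parity gives A^2 + O^2 = phi(q^2)^2, hence the product is 2
  phi(q^4)^2 - phi(q^2)^2; the same facts at q^2 turn this into phi(-q^2)^2.\<close>

lemma theta_phi_mult_phi_minus:
  "theta_phi * theta_phi_minus = dilate (theta_phi_minus * theta_phi_minus) 2"
proof -
  define O' where "O' = count_series {x. odd x} (\<lambda>x::int. x\<^sup>2)"
  have P4: "dilate theta_phi 4 = count_series {x. even x} (\<lambda>x::int. x\<^sup>2)"
    unfolding theta_phi_def dilate_count_series[OF zero_less_numeral]
    by (rule count_series_bij[where h = "\<lambda>x. 2 * x" and k
        = "\<lambda>x. x div 2"]) (auto simp: power2_eq_square)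
  have "count_series ({x. even x} \<union> {x. odd x}) (\<lambda>x::int. x\<^sup>2) = dilate theta_phi 4 + O'"
    unfolding P4 O'_def by (rule count_series_Un) (auto simp: finite_fibres_square)
  moreover have "{x. even x} \<union> {x. odd x} = (UNIV :: int set)" by auto
  ultimately have P: "theta_phi = dilate theta_phi 4 + O'" by (simp add: theta_phi_def)
  have "O' $ n = 0" if "even n" for n
  proof -
    have "{x \<in> {x. odd x}. x\<^sup>2 = int n} = {}"
      using that by (auto) (metis even_of_nat even_power pos2)
    then show ?thesis unfolding O'_def count_series_def fps_nth_Abs_fps by (simp only: card.empty)
  qed
  then have "theta_phi_minus $ n = (dilate theta_phi 4 - O') $ n" for n
    unfolding theta_phi_minus_def fps_compose_uminus_X_nth
    by (subst P, cases "even n") (auto simp: dilate_nth)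
  then have M: "theta_phi_minus = dilate theta_phi 4 - O'" by (simp add: fps_ext)
  have "dilate theta_phi 4 * dilate theta_phi 4 + O' * O'
      = count_series ({x. even x} \<times> {x. even x} \<union> {x. odd x} \<times> {x. odd x}) (\<lambda>(x, y). x\<^sup>2 + y\<^sup>2)"
    unfolding P4 O'_def
    by (subst (1 2) count_series_mult; (intro finite_fibres_square)?)
       (rule count_series_Un[symmetric], rule finite_fibres_subset[of "UNIV \<times> UNIV"],
         auto intro!: finite_fibres_Times finite_fibres_square simp del: UNIV_Times_UNIV)
  also have "\<dots> = count_series (UNIV \<times> UNIV) (\<lambda>(x, y). int 2 * x\<^sup>2 + int 2 * y\<^sup>2)"
    by (rule count_series_bij[where k = "\<lambda>(u, v). (u + v, u - v)"
          and h = "\<lambda>(x, y). ((x + y) div 2, (x - y) div 2)"])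
       (auto simp: power2_eq_square algebra_simps elim!: evenE oddE)
  also have "\<dots> = dilate theta_phi 2 * dilate theta_phi 2"
    unfolding theta_phi_def dilate_count_series[OF zero_less_numeral]
    by (intro count_series_mult[symmetric] finite_fibres_scale finite_fibres_square) auto
  finally have sq: "dilate theta_phi 4 * dilate theta_phi 4 + O' * O'
      = dilate theta_phi 2 * dilate theta_phi 2" .
  have P2: "dilate theta_phi 2 = dilate theta_phi 8 + dilate O' 2"
    by (subst P) (simp add: dilate_simps)
  have sq2: "dilate theta_phi 8 * dilate theta_phi 8 + dilate O' 2 * dilate O' 2
      = dilate theta_phi 4 * dilate theta_phi 4"
    using arg_cong[OF sq, of "\<lambda>f. dilate f 2"] by (simp add: dilate_simps)
  have M2: "dilate (theta_phi_minus * theta_phi_minus) 2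
      = (dilate theta_phi 8 - dilate O' 2) * (dilate theta_phi 8 - dilate O' 2)"
    by (simp add: M dilate_simps)
  have "theta_phi * theta_phi_minus
      = (dilate theta_phi 4 + O') * (dilate theta_phi 4 - O')"
    unfolding M by (subst P) simp
  also have "\<dots> = 2 * (dilate theta_phi 4 * dilate theta_phi 4)
      - (dilate theta_phi 4 * dilate theta_phi 4 + O' * O')"
    by (simp add: algebra_simps)
  finally show ?thesis
    unfolding M2 sq unfolding P2 sq2[symmetric] by (simp add: algebra_simps)
qed

section \<open>The quadratic relation for a(q)\<close>

lemma theta_X_nth_even: "even n \<Longrightarrow> theta_X $ n = 0"
proof -
  have "odd k \<Longrightarrow> (dilate theta_psi 2 * dilate theta_psi 6) $ k = 0" for k
  proof -
    assume "odd k"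
    \<comment> \<open>The product is a series in q^2, so the extra factor q makes X odd.\<close>
    have "dilate theta_psi 2 * dilate theta_psi 6 = dilate (theta_psi * dilate theta_psi 3) 2"
      by (simp add: dilate_simps)
    then show ?thesis using \<open>odd k\<close> by (simp add: dilate_nth)
  qed
  then show "even n \<Longrightarrow> theta_X $ n = 0"
    by (cases n) (auto simp: theta_X_def)
qed

text \<open>Replace q by -q in phi(q) phi(q^3) = a(q^4) + 2 X: the exponent 3 is odd, a(q^4) is even
  in q and X is odd.\<close>

lemma theta_phi_minus_mult:
  "theta_phi_minus * dilate theta_phi_minus 3 = dilate borwein_a 4 - 2 * theta_X"
proof -
  have *: "dilate theta_phi_minus 3 = dilate theta_phi 3 oo (- fps_X)"
    by (rule fps_ext) (auto simp: theta_phi_minus_def dilate_nth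
        fps_compose_uminus_X_nth elim!: dvdE
      simp: power_mult)
  have "theta_phi_minus * dilate theta_phi_minus 3
      = (theta_phi * dilate theta_phi 3) oo (- fps_X)"
    unfolding * unfolding theta_phi_minus_def by (rule fps_compose_mult_distrib[symmetric]) simp
  also have "\<dots> = dilate borwein_a 4 - 2 * theta_X"
    unfolding borwein_a_dissection(2)
  proof (rule fps_ext)
    fix n
    show "((dilate borwein_a 4 + 2 * theta_X) oo (- fps_X)) $ n
        = (dilate borwein_a 4 - 2 * theta_X) $ n"
      unfolding fps_compose_uminus_X_nth using theta_X_nth_even[of n]
      by (cases "even n") (auto simp: dilate_nth numeral_mult_fps_nth)
  qed
  finally show ?thesis .
qed

text \<open>For f = a this is 9 times phi(q) phi(-q) phi(q^3) phi(-q^3) = (phi(-q^2) phi(-q^6))^2,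
  with X eliminated by 6 X = a(q) - a(q^4). The right-hand side involves only dilations of
  \<open>f\<close>, which gives the relation its rigidity.\<close>

definition borwein_relation :: "int fps \<Rightarrow> bool" where
  "borwein_relation f \<longleftrightarrow>
     (f - dilate f 4) * (f - dilate f 4)
     = 9 * (dilate f 4 * dilate f 4)
       - (4 * dilate f 8 - dilate f 2) * (4 * dilate f 8 - dilate f 2)"

lemma borwein_relation_borwein_a: "borwein_relation borwein_a"
proof -
  let ?a = "dilate borwein_a"
  have X: "borwein_a - ?a 4 = 6 * theta_X"
    by (subst borwein_a_dissection(1)) simp
  have X2: "?a 2 = ?a 8 + 6 * dilate theta_X 2"
    by (subst borwein_a_dissection(1)) (simp add: dilate_simps)
  have "(?a 4 + 2 * theta_X) * (?a 4 - 2 * theta_X)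
      = (theta_phi * theta_phi_minus) * dilate (theta_phi * theta_phi_minus) 3"
    unfolding borwein_a_dissection(2)[symmetric] theta_phi_minus_mult[symmetric]
    by (simp add: dilate_simps algebra_simps)
  also have "\<dots> = dilate (theta_phi_minus * dilate theta_phi_minus 3) 2
      * dilate (theta_phi_minus * dilate theta_phi_minus 3) 2"
    unfolding theta_phi_mult_phi_minus by (simp add: dilate_simps algebra_simps)
  also have "\<dots> = (?a 8 - 2 * dilate theta_X 2) * (?a 8 - 2 * dilate theta_X 2)"
    unfolding theta_phi_minus_mult by (simp add: dilate_simps)
  finally have "9 * ((?a 4 + 2 * theta_X) * (?a 4 - 2 * theta_X))
    = 9 * ((?a 8 - 2 * dilate theta_X 2) * (?a 8 - 2 * dilate theta_X 2))" by simp
  then show ?thesis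
    unfolding borwein_relation_def X X2 by (simp add: algebra_simps)
qed

text \<open>If \<open>d = f - g\<close> had order m, then m \<ge> 2 by the first two coefficients.
  Subtracting the relations factors the left side as \<open>u * s\<close> with \<open>s\<close> = 2
  f_1 q + ..., so its coefficient at m + 1 is 2 f_1 d_m, which is nonzero. The right side consists
  of multiples of d(q^2), d(q^4) and d(q^8), of order at least 2 m > m + 1.\<close>

lemma borwein_relation_unique:
  assumes "borwein_relation f" "borwein_relation g"
    and "f $ 0 = g $ 0" "f $ 1 = g $ 1" "f $ 1 \<noteq> 0"
  shows "f = g"
proof (rule ccontr)
  assume "f \<noteq> g"
  define d where "d = f - g"
  define m where "m = subdegree d"
  have "d \<noteq> 0" using \<open>f \<noteq> g\<close> by (simp add: d_def)
  then have dm: "d $ m \<noteq> 0" by (simp add: m_def)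
  have d_less: "d $ i = 0" if "i < m" for i using that by (simp add: m_def nth_less_subdegree_zero)
  have m2: "m \<ge> 2"
    using dm assms(3,4) by (cases m; cases "m - 1") (auto simp: d_def)
  define s where "s = (f - dilate f 4) + (g - dilate g 4)"
  define u where "u = d - dilate d 4"
  have u_less: "u $ i = 0" if "i < m" for i
    using that d_less by (auto simp: u_def dilate_nth)
  have um: "u $ m = d $ m"
    using m2 d_less[of "m div 4"] by (auto simp: u_def dilate_nth)
  have s0: "s $ 0 = 0" "s $ 1 = 2 * f $ 1"
    using assms(4) by (auto simp: s_def dilate_nth)
  have dil_zero: "(dilate d k * h) $ Suc m = 0" if "k \<ge> 2" for k h
  proof -
    have "dilate d k $ i = 0" if "i \<le> Suc m" for i
    proof (cases "k dvd i")
      case True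
      then obtain j where "i = k * j" by blast
      moreover have "2 * j \<le> k * j" using \<open>k \<ge> 2\<close> by simp
      ultimately have "j < m" using \<open>i \<le> Suc m\<close> m2 by linarith
      then show ?thesis using d_less \<open>i = k * j\<close> \<open>k \<ge> 2\<close> by (simp add: dilate_nth)
    qed (use \<open>k \<ge> 2\<close> in \<open>simp add: dilate_nth\<close>)
    then show ?thesis by (simp add: fps_mult_nth)
  qed
  have "u * s = (f - dilate f 4) * (f - dilate f 4) - (g - dilate g 4) * (g - dilate g 4)"
    by (simp add: u_def s_def d_def dilate_simps algebra_simps)
  also have "\<dots> = dilate d 4 * (9 * (dilate f 4 + dilate g 4))
     - dilate d 8 * (4 * (4 * dilate f 8 - dilate f 2 + 4 * dilate g 8 - dilate g 2))
     + dilate d 2 * (4 * dilate f 8 - dilate f 2 + 4 * dilate g 8 - dilate g 2)"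
    unfolding assms(1,2)[unfolded borwein_relation_def]
    by (simp add: d_def dilate_simps algebra_simps)
  finally have "(u * s) $ Suc m = 0"
    by (simp only: fps_add_nth fps_sub_nth dil_zero)
  moreover have "(u * s) $ Suc m = (\<Sum>i = 0..Suc m. if i = m then u $ m * s $ 1 else 0)"
    unfolding fps_mult_nth
  proof (rule sum.cong)
    fix i assume "i \<in> {0..Suc m}"
    then consider "i < m" | "i = m" | "i = Suc m" by force
    then show "u $ i * s $ (Suc m - i) = (if i = m then u $ m * s $ 1 else 0)"
      by cases (auto simp: u_less s0)
  qed simp
  ultimately show False using dm um s0 assms(5) by simp
qed

section \<open>Liouville's identity\<close>

text \<open>Here \<open>a\<close> is a divisor of i = \<open>a * x\<close> and \<open>b\<close> one
  of n - i, with cofactors \<open>x\<close> and \<open>y\<close>, so sums over this set are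
  coefficients of products of divisor series.\<close>

definition pos_quads :: "nat \<Rightarrow> (nat \<times> nat \<times> nat \<times> nat) set" where
  "pos_quads n = {(a, b, x, y). 0 < a \<and> 0 < b \<and> 0 < x \<and> 0 < y \<and> a * x + b * y = n}"

lemma finite_pos_quads: "finite (pos_quads n)"
proof (rule finite_subset)
  have "a \<le> a * x + b * y \<and> b \<le> a * x + b * y \<and> x \<le> a * x + b * y \<and> y \<le> a * x + b * y"
    if "0 < a" "0 < b" "0 < x" "0 < y" for a b x y :: nat
    using that by (auto intro: trans_le_add1 trans_le_add2)
  then show "pos_quads n \<subseteq> {..n} \<times> {..n} \<times> {..n} \<times> {..n}"
    by (auto simp: pos_quads_def)
qed simp

lemma sum_pos_quads_split:
  fixes f :: "nat \<times> nat \<times> nat \<times> nat \<Rightarrow> int"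
  shows "sum f (pos_quads n) = (\<Sum>(a, b, x, y) | (a, b, x, y) \<in> pos_quads n \<and> g a b x y < h a b x
      y. f (a, b, x, y))
    + (\<Sum>(a, b, x, y) | (a, b, x, y) \<in> pos_quads n \<and> g a b x y = (h a b x y :: nat). f (a, b, x, y))
    + (\<Sum>(a, b, x, y) | (a, b, x, y) \<in> pos_quads n \<and> h a b x y < g a b x y. f (a, b, x, y))"
    (is "_ = sum _ ?A + sum _ ?B + sum _ ?C")
proof -
  have fin: "finite ?A" "finite ?B" "finite ?C"
    by (rule finite_subset[OF _ finite_pos_quads[of n]]; auto)+
  have "sum f (pos_quads n) = sum f (?A \<union> ?B \<union> ?C)"
    by (rule sum.cong) auto
  also have "\<dots> = sum f ?A + sum f ?B + sum f ?C"
    using fin by (subst sum.union_disjoint; auto simp: disjoint_iff)+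
  finally show ?thesis by (simp add: case_prod_unfold)
qed

text \<open>A common value d = a = b must divide \<open>n\<close>, and x + y = n/d has n/d - 1
  positive solutions.\<close>

lemma sum_pos_quads_eq_coeffs:
  assumes "n > 0"
  shows "(\<Sum>(a, b, x, y) | (a, b, x, y) \<in> pos_quads n \<and> a = b. (f a :: int))
       = (\<Sum>d | d dvd n. (int (n div d) - 1) * f d)"
proof -
  have "(\<Sum>(a, b, x, y) | (a, b, x, y) \<in> pos_quads n \<and> a = b. f a)
      = (\<Sum>(d, x)\<in>(SIGMA d:{d. d dvd n}. {1..<n div d}). f d)"
  proof (rule sum.reindex_bij_witness[where j = "\<lambda>(a, b, x, y). (a, x)"
        and i = "\<lambda>(d, x). (d, d, x, n div d - x)"], goal_cases)
    case (2 p)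
    then show ?case
      by (auto simp: pos_quads_def simp flip: distrib_left)
  next
    case (4 p)
    then obtain d k x where "p = (d, x)" "n = d * k" "1 \<le> x" "x < k" "0 < d"
      using assms by (auto elim!: dvdE)
    then show ?case
      by (auto simp: pos_quads_def simp flip: distrib_left)
  qed (use assms in \<open>auto simp: pos_quads_def simp flip: distrib_left\<close>)
  also have "\<dots> = (\<Sum>d | d dvd n. \<Sum>x\<in>{1..<n div d}. f d)"
    using assms by (subst sum.Sigma) auto
  also have "\<dots> = (\<Sum>d | d dvd n. (int (n div d) - 1) * f d)"
  proof (rule sum.cong)
    fix d assume "d \<in> {d. d dvd n}"
    then have "n div d \<ge> 1" using assms by (auto elim!: dvdE)
    then show "(\<Sum>x\<in>{1..<n div d}. f d) = (int (n div d) - 1) * f d" by (simp add: of_nat_diff)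
  qed simp
  finally show ?thesis .
qed

text \<open>If x = y, then d = a + b divides \<open>n\<close> with cofactor x, and l = a can be any
  of 1, ..., d - 1.\<close>

lemma sum_pos_quads_eq_cofactors:
  assumes "n > 0"
  shows "(\<Sum>(a, b, x, y) | (a, b, x, y) \<in> pos_quads n \<and> x = y. (f a (a + b) :: int))
       = (\<Sum>d | d dvd n. \<Sum>l\<in>{1..<d}. f l d)"
proof -
  have "(\<Sum>(a, b, x, y) | (a, b, x, y) \<in> pos_quads n \<and> x = y. f a (a + b))
      = (\<Sum>(d, l)\<in>(SIGMA d:{d. d dvd n}. {1..<d}). f l d)"
    by (rule sum.reindex_bij_witness[where j = "\<lambda>(a, b, x, y). (a + b, a)"
        and i = "\<lambda>(d, l). (l, d - l, n div d, n div d)"])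
      (use assms in \<open>auto simp: pos_quads_def elim!: dvdE simp flip: distrib_right\<close>)
  also have "\<dots> = (\<Sum>d | d dvd n. \<Sum>l\<in>{1..<d}. f l d)"
    using assms by (subst sum.Sigma) auto
  finally show ?thesis .
qed

text \<open>Every substitution below is one step of the Euclidean algorithm on the
  pairs \<open>(a, b)\<close> and \<open>(x, y)\<close>, keeping the value of \<open>a * x + b * y\<close>.\<close>

lemma liouville_identity:
  fixes F :: "int \<Rightarrow> int"
  assumes n: "n > 0" and even: "\<And>k. F (- k) = F k"
  shows "(\<Sum>(a, b, x, y)\<in>pos_quads n. F (int a - int b) - F (int a + int b))
    = (\<Sum>d | d dvd n. (int (n div d) - 1) * F 0 + 2 * ((int (n div d) - 1) * F (int d))
        - 2 * (\<Sum>l\<in>{1..<d}. F (int l)) - (int d - 1) * F (int d))"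
proof -
  let ?Q = "pos_quads n"
  let ?S = "\<lambda>f P. \<Sum>(a, b, x, y) | (a, b, x, y) \<in> ?Q \<and> P a b x y. (f a b :: int)"
  have le: "b * x \<le> a * x + b * y" if "b < a \<or> x < y" for a b x y :: nat
    using that by (auto simp: trans_le_add1 trans_le_add2)
  have le': "a * y \<le> a * x + b * y" if "y < x \<or> a < b" for a b x y :: nat
    using that by (auto simp: trans_le_add1 trans_le_add2)
  have 1: "?S (\<lambda>a b. F (int a - int b)) (\<lambda>a b x y. b < a) = ?S (\<lambda>a b. F (int a)) (\<lambda>a b x y. x < y)"
    by (rule sum.reindex_bij_witness[where j = "\<lambda>(a, b, x, y). (a - b, b, x, x + y)"
        and i = "\<lambda>(a, b, x, y). (a + b, b, x, y - x)"])
      (auto simp: pos_quads_def algebra_simps diff_mult_distrib diff_mult_distrib2 of_nat_diff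
        le le')
  have 2: "?S (\<lambda>a b. F (int a - int b)) (\<lambda>a b x y. a < b)
      = ?S (\<lambda>a b. F (int a - int b)) (\<lambda>a b x y. b < a)"
    by (rule sum.reindex_bij_witness[where j = "\<lambda>(a, b, x, y). (b, a, y, x)"
        and i = "\<lambda>(a, b, x, y). (b, a, y, x)"])
      (auto simp: pos_quads_def algebra_simps, metis even minus_diff_eq)
  have 3: "?S (\<lambda>a b. F (int a + int b)) (\<lambda>a b x y. x < y) = ?S (\<lambda>a b. F (int a)) (\<lambda>a b x y. b < a)"
    by (rule sum.reindex_bij_witness[where j = "\<lambda>(a, b, x, y). (a + b, b, x, y - x)"
        and i = "\<lambda>(a, b, x, y). (a - b, b, x, x + y)"])
      (auto simp: pos_quads_def algebra_simps diff_mult_distrib diff_mult_distrib2 of_nat_diff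
        le le')
  have 4: "?S (\<lambda>a b. F (int a + int b)) (\<lambda>a b x y. y < x)
      = ?S (\<lambda>a b. F (int a + int b)) (\<lambda>a b x y. x < y)"
    by (rule sum.reindex_bij_witness[where j = "\<lambda>(a, b, x, y). (b, a, y, x)"
        and i = "\<lambda>(a, b, x, y). (b, a, y, x)"])
      (auto simp: pos_quads_def algebra_simps)
  have 5: "?S (\<lambda>a b. F (int a)) (\<lambda>a b x y. a < b) = ?S (\<lambda>a b. F (int a)) (\<lambda>a b x y. y < x)"
    by (rule sum.reindex_bij_witness[where j = "\<lambda>(a, b, x, y). (a, b - a, x + y, y)"
        and i = "\<lambda>(a, b, x, y). (a, b + a, x - y, y)"])
      (auto simp: pos_quads_def algebra_simps diff_mult_distrib diff_mult_distrib2 of_nat_diff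
        le le')
  have "(\<Sum>(a, b, x, y)\<in>?Q. F (int a - int b) - F (int a + int b))
      = (\<Sum>(a, b, x, y)\<in>?Q. F (int a - int b)) - (\<Sum>(a, b, x, y)\<in>?Q. F (int a + int b))"
    by (simp add: case_prod_unfold sum_subtractf)
  also have "(\<Sum>(a, b, x, y)\<in>?Q. F (int a - int b))
      = ?S (\<lambda>a b. F (int a - int b)) (\<lambda>a b x y. a < b) + ?S (\<lambda>a b. F (int a
          - int b)) (\<lambda>a b x y. a = b)
        + ?S (\<lambda>a b. F (int a - int b)) (\<lambda>a b x y. b < a)"
    by (subst sum_pos_quads_split[where g = "\<lambda>a b x y. a" and h = "\<lambda>a b x y. b"]) simp
  also have "(\<Sum>(a, b, x, y)\<in>?Q. F (int a + int b))
      = ?S (\<lambda>a b. F (int a + int b)) (\<lambda>a b x y. x < y) + ?S (\<lambda>a b. F (int a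
          + int b)) (\<lambda>a b x y. x = y)
        + ?S (\<lambda>a b. F (int a + int b)) (\<lambda>a b x y. y < x)"
    by (subst sum_pos_quads_split[where g = "\<lambda>a b x y. x" and h = "\<lambda>a b x y. y"]) simp
  \<comment> \<open>The off-diagonal parts of F(a - b) contribute F(a) twice over x < y, evenness of
    \<open>F\<close> entering in \<open>2\<close>; those of F(a + b) contribute F(a) twice over b <
    a.\<close>
  finally have A: "(\<Sum>(a, b, x, y)\<in>?Q. F (int a - int b) - F (int a + int b))
      = 2 * ?S (\<lambda>a b. F (int a)) (\<lambda>a b x y. x < y) + ?S (\<lambda>a b. F (int a - int b)) (\<lambda>a b x y. a = b)
      - 2 * ?S (\<lambda>a b. F (int a)) (\<lambda>a b x y. b < a) - ?S (\<lambda>a b. F (int a + int b)) (\<lambda>a b x y. x = y)"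
    unfolding 2 4 1 3 by linarith
  \<comment> \<open>Split the sum of F(a) over all quadruples once by x against y and once by a
    against b. By \<open>5\<close> the parts y < x and a < b agree, so the difference left open in
    \<open>A\<close> reduces to diagonals.\<close>
  have "?S (\<lambda>a b. F (int a)) (\<lambda>a b x y. x < y) + ?S (\<lambda>a b. F (int a)) (\<lambda>a b x y. x = y)
        + ?S (\<lambda>a b. F (int a)) (\<lambda>a b x y. y < x) = (\<Sum>(a, b, x, y)\<in>?Q. F (int a))"
    by (subst sum_pos_quads_split[where g = "\<lambda>a b x y. x" and h = "\<lambda>a b x y. y"]) simp
  also have "\<dots> = ?S (\<lambda>a b. F (int a)) (\<lambda>a b x y. a < b) + ?S (\<lambda>a b. F (int a)) (\<lambda>a b x y. a = b)
        + ?S (\<lambda>a b. F (int a)) (\<lambda>a b x y. b < a)"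
    by (subst sum_pos_quads_split[where g = "\<lambda>a b x y. a" and h = "\<lambda>a b x y. b"]) simp
  finally have B: "?S (\<lambda>a b. F (int a)) (\<lambda>a b x y. x < y) - ?S (\<lambda>a b. F (int a)) (\<lambda>a b x y. b < a)
      = ?S (\<lambda>a b. F (int a)) (\<lambda>a b x y. a = b) - ?S (\<lambda>a b. F (int a)) (\<lambda>a b x y. x = y)"
    unfolding 5 by linarith
  have C: "?S (\<lambda>a b. F (int a - int b)) (\<lambda>a b x y. a = b) = ?S (\<lambda>a b. F 0) (\<lambda>a b x y. a = b)"
    by (rule sum.cong) auto
  have D: "?S (\<lambda>a b. F (int a + int b)) (\<lambda>a b x y. x = y) = (\<Sum>d | d dvd n. (int d - 1) * F (int d))"
  proof -
    have "?S (\<lambda>a b. F (int a + int b)) (\<lambda>a b x y. x = y) = (\<Sum>d | d dvd n. \<Sum>l\<in>{1..<d}. F (int d))"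
      using sum_pos_quads_eq_cofactors[OF n, of "\<lambda>a s. F (int s)"] by simp
    also have "\<dots> = (\<Sum>d | d dvd n. (int d - 1) * F (int d))"
    proof (rule sum.cong)
      fix d assume "d \<in> {d. d dvd n}"
      then have "d \<ge> 1" using n by (auto elim!: dvdE)
      then show "(\<Sum>l\<in>{1..<d}. F (int d)) = (int d - 1) * F (int d)" by (simp add: of_nat_diff)
    qed simp
    finally show ?thesis .
  qed
  have "(\<Sum>(a, b, x, y)\<in>?Q. F (int a - int b) - F (int a + int b))
    = ?S (\<lambda>a b. F 0) (\<lambda>a b x y. a = b) + 2 * ?S (\<lambda>a b. F (int a)) (\<lambda>a b x y. a = b)
      - 2 * ?S (\<lambda>a b. F (int a)) (\<lambda>a b x y. x = y) - (\<Sum>d | d dvd n. (int d - 1) * F (int d))"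
    using A B unfolding C D by linarith
  also have "?S (\<lambda>a b. F 0) (\<lambda>a b x y. a = b) = (\<Sum>d | d dvd n. (int (n div d) - 1) * F 0)"
    by (rule sum_pos_quads_eq_coeffs[OF n])
  also have "?S (\<lambda>a b. F (int a)) (\<lambda>a b x y. a = b)
      = (\<Sum>d | d dvd n. (int (n div d) - 1) * F (int d))"
    by (rule sum_pos_quads_eq_coeffs[OF n])
  also have "?S (\<lambda>a b. F (int a)) (\<lambda>a b x y. x = y) = (\<Sum>d | d dvd n. \<Sum>l\<in>{1..<d}. F (int l))"
    by (rule sum_pos_quads_eq_cofactors[OF n])
  finally show ?thesis
    by (simp only: sum_subtractf sum.distrib sum_distrib_left)
qed

text \<open>The set of divisors of 0 is infinite, so the constant coefficient is the junk value 0 of an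
  infinite sum, as intended.\<close>

definition divisor_series :: "(nat \<Rightarrow> int) \<Rightarrow> int fps" where
  "divisor_series g = Abs_fps (\<lambda>n. \<Sum>d | d dvd n. g d)"

lemma divisor_series_nth_0: "divisor_series g $ 0 = 0"
  by (simp add: divisor_series_def)

lemma divisor_series_mult_nth:
  "(divisor_series g * divisor_series h) $ n = (\<Sum>(a, b, x, y)\<in>pos_quads n. g a * h b)"
proof -
  let ?I = "SIGMA i:{1..<n}. {d. d dvd i} \<times> {d. d dvd n - i}"
  have "(divisor_series g * divisor_series h) $ n
      = (\<Sum>i\<in>{0..n}. divisor_series g $ i * divisor_series h $ (n - i))"
    by (simp add: fps_mult_nth)
  \<comment> \<open>The vanishing constant coefficients remove the end terms i = 0 and i = n, so
    both cofactors are positive.\<close>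
  also have "\<dots> = (\<Sum>i\<in>{1..<n}. divisor_series g $ i * divisor_series h $ (n - i))"
    by (rule sum.mono_neutral_right) (auto simp: divisor_series_nth_0 Suc_le_eq intro!: Nat.gr0I)
  also have "\<dots> = (\<Sum>i\<in>{1..<n}. \<Sum>(a, b)\<in>{d. d dvd i} \<times> {d. d dvd n - i}. g a * h b)"
    by (simp add: divisor_series_def sum_product sum.cartesian_product)
  also have "\<dots> = (\<Sum>(i, a, b)\<in>?I. g a * h b)"
    by (subst sum.Sigma) (auto simp: case_prod_unfold)
  also have "\<dots> = (\<Sum>(a, b, x, y)\<in>pos_quads n. g a * h b)"
    by (rule sum.reindex_bij_witness[where j = "\<lambda>(i, a, b). (a, b, i div a, (n - i) div b)"
        and i = "\<lambda>(a, b, x, y). (a * x, a, b)"])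
      (auto simp: pos_quads_def dvd_div_eq_0_iff elim!: dvd_pos_nat[rotated] intro!: Nat.gr0I)
  finally show ?thesis .
qed

lemma sum_divisors_multiples:
  fixes g :: "nat \<Rightarrow> int"
  assumes "n > 0" "k > 0"
  shows "(\<Sum>d | d dvd n. if k dvd d then g d else 0)
       = (if k dvd n then \<Sum>d | d dvd n div k. g (k * d) else 0)"
proof -
  have "(\<Sum>d | d dvd n. if k dvd d then g d else 0) = (\<Sum>d | d dvd n \<and> k dvd d. g d)"
    using assms sum.inter_filter[of "{d. d dvd n}" g "\<lambda>d. k dvd d"] by simp
  also have "\<dots> = (if k dvd n then \<Sum>d | d dvd n div k. g (k * d) else 0)"
  proof (cases "k dvd n")
    case True
    have "(\<Sum>d | d dvd n \<and> k dvd d. g d) = (\<Sum>d | d dvd n div k. g (k * d))"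
      by (rule sum.reindex_bij_witness[where j = "\<lambda>d. d div k" and i = "\<lambda>d. k * d"])
         (use True assms in \<open>auto elim!: dvdE\<close>)
    with True show ?thesis by simp
  next
    case False
    then have "{d. d dvd n \<and> k dvd d} = {}" using dvd_trans by blast
    with False show ?thesis by (simp only: sum.empty if_False)
  qed
  finally show ?thesis .
qed

definition sigma_series :: "int fps" where
  "sigma_series = divisor_series int"

text \<open>Divisors k d' of \<open>n\<close> add up to k sigma(n/k), whereas their cofactors
  (n/k)/d' run through the divisors of n/k and add up to sigma(n/k) itself.\<close>

lemma sum_multiples_eq_dilate_sigma:
  assumes "n > 0" "k > 0"
  shows "(\<Sum>d | d dvd n. if k dvd d then int d else 0) = int k * dilate sigma_series k $ n"
    and "(\<Sum>d | d dvd n. if k dvd d then int (n div d) else 0) = dilate sigma_series k $ n"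
proof -
  show "(\<Sum>d | d dvd n. if k dvd d then int d else 0) = int k * dilate sigma_series k $ n"
    unfolding sum_divisors_multiples[OF assms] using assms
    by (auto simp: dilate_nth sigma_series_def divisor_series_def sum_distrib_left)
  have "(\<Sum>d | d dvd m. int (m div d)) = (\<Sum>d | d dvd m. int d)" if "m > 0" for m
    by (rule sum.reindex_bij_witness[where j = "\<lambda>d. m div d" and i = "\<lambda>d. m div d"])
       (use that in \<open>auto elim!: dvdE\<close>)
  then show "(\<Sum>d | d dvd n. if k dvd d then int (n div d) else 0) = dilate sigma_series k $ n"
    unfolding sum_divisors_multiples[OF assms] using assms
    by (auto simp: dilate_nth sigma_series_def divisor_series_def div_mult2_eq elim!: dvdE)
qed

section \<open>The Lambert series\<close>

text \<open>\<open>chi3 d\<close>, \<open>chi6 d\<close> and \<open>cos6 d\<close> below are \<open>2 / sqrt 3 * sin (2 * pi * d / 3)\<close>,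
  \<open>2 / sqrt 3 * sin (pi * d / 3)\<close> and \<open>2 * cos (pi * d / 3)\<close>, so that the product-to-sum formula for
  sines brings the squares of their divisor sums into the shape of Liouville's identity.\<close>

definition chi3 :: "nat \<Rightarrow> int" where
  "chi3 d = (if d mod 3 = 1 then 1 else if d mod 3 = 2 then - 1 else 0)"

definition chi6 :: "nat \<Rightarrow> int" where
  "chi6 d = (if d mod 6 \<in> {1, 2} then 1 else if d mod 6 \<in> {4, 5} then - 1 else 0)"

definition lambert_a :: "int fps" where
  "lambert_a = 1 + 6 * divisor_series chi3"

lemma sum_multiples_of_3: "(\<Sum>l\<in>{1..<d}. if 3 dvd int l then 1 else (0::int)) = (int d - 1) div 3"
  if "d > 0"
  using that
proof (induction d rule: nat_induct_non_zero)
  case (Suc d)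
  then have "(\<Sum>l\<in>{1..<Suc d}. if 3 dvd int l then 1 else (0::int))
      = (int d - 1) div 3 + (if 3 dvd int d then 1 else 0)"
    by (simp add: sum.atLeastLessThan_Suc)
  also have "\<dots> = (int (Suc d) - 1) div 3" by (simp, presburger)
  finally show ?case .
qed simp

text \<open>Product-to-sum with 2 cos(2 pi k/3) = 3 [3 | k] - 1: the constants cancel, leaving the
  even function k -> [3 | k] for Liouville's identity.\<close>

lemma chi3_mult:
  "chi3 a * chi3 b = (if 3 dvd int a - int b then 1 else 0) - (if 3 dvd int a
      + int b then 1 else 0)"
proof -
  have "a mod 3 \<in> {0, 1, 2}" "b mod 3 \<in> {0, 1, 2}" by auto
  moreover have "3 dvd int a - int b \<longleftrightarrow> a mod 3 = b mod 3" by presburger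
  moreover have "3 dvd int a + int b \<longleftrightarrow> (a mod 3 + b mod 3) mod 3 = 0" by presburger
  ultimately show ?thesis by (auto simp: chi3_def)
qed

text \<open>Liouville's identity for the indicator of multiples of 3. The inner sum is the floor of
  (d - 1)/3, and its dependence on d modulo 3 is where \<open>chi3\<close> returns; the factor 3
  clears the fraction.\<close>

lemma divisor_series_chi3_square:
  "3 * (divisor_series chi3 * divisor_series chi3)
   = sigma_series - 3 * dilate sigma_series 3 - divisor_series chi3"
proof (rule fps_ext)
  fix n
  let ?S = "\<lambda>k. dilate sigma_series k"
  show "(3 * (divisor_series chi3 * divisor_series chi3)) $ n
   = (sigma_series - 3 * ?S 3 - divisor_series chi3) $ n"
  proof (cases "n = 0")
    case True
    then show ?thesis
      by (simp add: divisor_series_nth_0 dilate_nth numeral_mult_fps_nth sigma_series_def)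
  next
    case False
    then have n: "n > 0" by simp
    define F where "F = (\<lambda>k::int. if 3 dvd k then 1 else (0::int))"
    let ?t = "\<lambda>d. (int (n div d) - 1) * F 0 + 2 * ((int (n div d) - 1) * F (int d))
        - 2 * (\<Sum>l\<in>{1..<d}. F (int l)) - (int d - 1) * F (int d)"
    have "(divisor_series chi3 * divisor_series chi3) $ n
        = (\<Sum>(a, b, x, y)\<in>pos_quads n. F (int a - int b) - F (int a + int b))"
      by (simp add: divisor_series_mult_nth chi3_mult F_def)
    also have "\<dots> = (\<Sum>d | d dvd n. ?t d)"
      by (rule liouville_identity[OF n]) (simp add: F_def)
    finally have "3 * (divisor_series chi3 * divisor_series chi3) $ n = (\<Sum>d | d dvd n. 3 * ?t d)"
      by (simp only: sum_distrib_left)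
    also have "\<dots> = (\<Sum>d | d dvd n. 3 * (if 1 dvd d then int (n div d) else 0)
        + 6 * (if 3 dvd d then int (n div d) else 0)
        - 2 * (if 1 dvd d then int d else 0) - 3 * (if 3 dvd d then int d else 0) - chi3 d)"
    proof (rule sum.cong)
      fix d assume "d \<in> {d. d dvd n}"
      then have "d > 0" using n by (auto intro: Nat.gr0I)
      have "(\<Sum>l\<in>{1..<d}. F (int l)) = (int d - 1) div 3"
        unfolding F_def by (rule sum_multiples_of_3[OF \<open>d > 0\<close>])
      moreover have "- 3 - 3 * F (int d) - 6 * ((int d - 1) div 3) = - 2 * int d - chi3 d"
      proof -
        have "d mod 3 = 0 \<or> d mod 3 = 1 \<or> d mod 3 = 2" by auto
        moreover have "d mod 3 = 0 \<Longrightarrow> 3 * ((int d - 1) div 3) = int d - 3" by presburger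
        moreover have "d mod 3 = 1 \<Longrightarrow> 3 * ((int d - 1) div 3) = int d - 1" by presburger
        moreover have "d mod 3 = 2 \<Longrightarrow> 3 * ((int d - 1) div 3) = int d - 2" by presburger
        moreover have "3 dvd int d \<longleftrightarrow> d mod 3 = 0" by presburger
        ultimately show ?thesis by (auto simp: F_def chi3_def)
      qed
      moreover have "3 dvd int d \<longleftrightarrow> 3 dvd d" by presburger
      ultimately show "3 * ?t d = 3 * (if 1 dvd d then int (n div d) else 0)
        + 6 * (if 3 dvd d then int (n div d) else 0)
        - 2 * (if 1 dvd d then int d else 0) - 3 * (if 3 dvd d then int d else 0) - chi3 d"
        by (auto simp: F_def algebra_simps)
    qed simp
    also have "\<dots> = 3 * ?S 1 $ n + 6 * ?S 3 $ n - 2 * (int 1 * ?S 1 $ n) - 3 * (int 3 * ?S 3 $ n)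
        - divisor_series chi3 $ n"
      unfolding sum.distrib sum_subtractf sum_distrib_left[symmetric]
        sum_multiples_eq_dilate_sigma[OF n zero_less_one]
        sum_multiples_eq_dilate_sigma[OF n zero_less_numeral]
      by (simp add: divisor_series_def)
    finally show ?thesis by (simp add: numeral_mult_fps_nth)
  qed
qed

definition cos6 :: "int \<Rightarrow> int" where
  "cos6 k = (if k mod 6 = 0 then 2 else if k mod 6 \<in> {1, 5} then 1 else if k mod 6 = 3 then - 2
     else - 1)"

lemma mod_6_cases:
  "(a::nat) mod 6 = 0 \<or> a mod 6 = 1 \<or> a mod 6 = 2 \<or> a mod 6 = 3 \<or> a mod 6 = 4 \<or> a mod 6 = 5"
  by presburger

lemma cos6_minus: "cos6 (- k) = cos6 k"
proof -
  have "(- k) mod 6 = (if k mod 6 = 0 then 0 else 6 - k mod 6)"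
    by (simp add: zmod_zminus1_eq_if)
  moreover have "0 \<le> k mod 6" "k mod 6 < 6" by auto
  ultimately show ?thesis by (auto simp: cos6_def)
qed

lemma chi6_mult: "3 * (chi6 a * chi6 b) = cos6 (int a - int b) - cos6 (int a + int b)"
proof -
  have "(int a - int b) mod 6 = (int (a mod 6) - int (b mod 6)) mod 6"
    "(int a + int b) mod 6 = (int (a mod 6) + int (b mod 6)) mod 6"
    by (simp_all add: zmod_int mod_diff_eq mod_add_eq)
  then show ?thesis
    using mod_6_cases[of a] mod_6_cases[of b]
    by (elim disjE) (simp_all add: cos6_def chi6_def)
qed

lemma int_mod_6: "int d mod 6 = int (d mod 6)"
  by (simp add: zmod_int)

text \<open>\<open>cos6\<close> is the Ramanujan sum c_6, here expanded over the divisors of 6; in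
  this shape its sums over the divisors of \<open>n\<close> become combinations of dilated sigma
  series.\<close>

lemma cos6_eq:
  "cos6 (int d) = 1 - 2 * (if 2 dvd d then 1 else 0) - 3 * (if 3 dvd d then 1 else 0)
     + 6 * (if 6 dvd d then 1 else 0)"
proof -
  have "2 dvd d \<longleftrightarrow> d mod 6 \<in> {0, 2, 4}" "3 dvd d \<longleftrightarrow> d mod 6 \<in> {0, 3}" "6 dvd d \<longleftrightarrow> d mod 6 = 0"
    by (auto; presburger)+
  then show ?thesis
    using mod_6_cases[of d] by (elim disjE) (simp_all add: cos6_def int_mod_6)
qed

text \<open>Telescoping via cos6(d) + cos6(d + 1) = 3 (chi6(d + 1) - chi6(d)). The left side is the
  part of Liouville's right-hand side that carries neither d nor n/d as a factor.\<close>

lemma sum_cos6: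
  assumes "d > 0"
  shows "- 2 - cos6 (int d) - 2 * (\<Sum>l\<in>{1..<d}. cos6 (int l)) = - 3 * chi6 d"
  using assms
proof (induction d rule: nat_induct_non_zero)
  case 1
  show ?case by (simp add: cos6_def chi6_def)
next
  case (Suc d)
  have *: "(\<Sum>l\<in>{1..<Suc d}. cos6 (int l)) = (\<Sum>l\<in>{1..<d}. cos6 (int l)) + cos6 (int d)"
    using Suc.hyps by (simp add: sum.atLeastLessThan_Suc)
  have "Suc d mod 6 = (d mod 6 + 1) mod 6" by (simp add: mod_simps)
  then have "- cos6 (int (Suc d)) - cos6 (int d) = - 3 * chi6 (Suc d) + 3 * chi6 d"
    using mod_6_cases[of d]
    by (elim disjE) (simp_all only: cos6_def chi6_def int_mod_6, simp_all)
  then have "(- 2 - cos6 (int d) - 2 * (\<Sum>l\<in>{1..<d}. cos6 (int l)))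
      + (- cos6 (int (Suc d)) - cos6 (int d)) = - 3 * chi6 (Suc d)"
    unfolding Suc.IH by simp
  then show ?case unfolding * by (simp add: algebra_simps)
qed

text \<open>Same scheme with \<open>F = cos6\<close>. The sigma terms at q^2 cancel, -4 coming from
  cofactors and 2 times 2 from divisors, which leaves only q, q^3 and q^6.\<close>

lemma divisor_series_chi6_square:
  "3 * (divisor_series chi6 * divisor_series chi6)
   = 3 * sigma_series + 3 * dilate sigma_series 3 - 24 * dilate sigma_series 6
     - 3 * divisor_series chi6"
proof (rule fps_ext)
  fix n
  let ?S = "\<lambda>k. dilate sigma_series k"
  show "(3 * (divisor_series chi6 * divisor_series chi6)) $ n
   = (3 * sigma_series + 3 * ?S 3 - 24 * ?S 6 - 3 * divisor_series chi6) $ n"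
  proof (cases "n = 0")
    case True
    then show ?thesis
      by (simp add: divisor_series_nth_0 dilate_nth numeral_mult_fps_nth sigma_series_def)
  next
    case False
    then have n: "n > 0" by simp
    let ?t = "\<lambda>d. (int (n div d) - 1) * cos6 0 + 2 * ((int (n div d) - 1) * cos6 (int d))
        - 2 * (\<Sum>l\<in>{1..<d}. cos6 (int l)) - (int d - 1) * cos6 (int d)"
    let ?u = "\<lambda>d. 4 * (if 1 dvd d then int (n div d) else 0)
        - 4 * (if 2 dvd d then int (n div d) else 0)
        - 6 * (if 3 dvd d then int (n div d) else 0)
        + 12 * (if 6 dvd d then int (n div d) else 0)
        - (if 1 dvd d then int d else 0)
        + 2 * (if 2 dvd d then int d else 0)
        + 3 * (if 3 dvd d then int d else 0)
        - 6 * (if 6 dvd d then int d else 0)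
        - 3 * chi6 d"
    have "3 * (divisor_series chi6 * divisor_series chi6) $ n
        = (\<Sum>(a, b, x, y)\<in>pos_quads n. cos6 (int a - int b) - cos6 (int a + int b))"
      by (simp add: divisor_series_mult_nth sum_distrib_left case_prod_unfold flip: chi6_mult)
    also have "\<dots> = (\<Sum>d | d dvd n. ?t d)"
      by (rule liouville_identity[where F = cos6, OF n cos6_minus])
    also have "\<dots> = (\<Sum>d | d dvd n. ?u d)"
    proof (rule sum.cong)
      fix d assume "d \<in> {d. d dvd n}"
      then have "d > 0" using n by (auto intro: Nat.gr0I)
      have c0: "cos6 0 = 2" by (simp add: cos6_def)
      have "?t d = 2 * int (n div d) + 2 * (int (n div d) * cos6 (int d)) - int d * cos6 (int d)
          + (- 2 - cos6 (int d) - 2 * (\<Sum>l\<in>{1..<d}. cos6 (int l)))"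
        by (simp add: c0 algebra_simps)
      also have "\<dots> = ?u d"
        unfolding sum_cos6[OF \<open>d > 0\<close>] unfolding cos6_eq by (simp add: algebra_simps)
      finally show "?t d = ?u d" .
    qed simp
    also have "\<dots> = 4 * ?S 1 $ n - 4 * ?S 2 $ n - 6 * ?S 3 $ n + 12 * ?S 6 $ n
        - int 1 * ?S 1 $ n + 2 * (int 2 * ?S 2 $ n) + 3 * (int 3 * ?S 3 $ n) - 6
            * (int 6 * ?S 6 $ n)
        - 3 * divisor_series chi6 $ n"
      unfolding sum.distrib sum_subtractf sum_distrib_left[symmetric]
        sum_multiples_eq_dilate_sigma[OF n zero_less_one]
        sum_multiples_eq_dilate_sigma[OF n zero_less_numeral]
      by (simp add: divisor_series_def)
    finally show ?thesis by (simp add: numeral_mult_fps_nth)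
  qed
qed

text \<open>At odd d the values of \<open>chi6\<close> and \<open>chi3\<close> agree; at even d,
  \<open>chi6 d\<close> is chi3(d/2), which equals -chi3(d). Thus L(q) + 2 L(q^2) is 3 plus 6 times
  the \<open>chi6\<close> series.\<close>

lemma divisor_series_chi6:
  "divisor_series chi6 = divisor_series chi3 + 2 * dilate (divisor_series chi3) 2"
proof (rule fps_ext)
  fix n
  have *: "chi6 d = chi3 d + 2 * (if 2 dvd d then chi3 (d div 2) else 0)" for d
  proof -
    have "2 dvd d \<longleftrightarrow> d mod 6 \<in> {0, 2, 4}" by (auto; presburger)
    moreover have "d mod 3 = d mod 6 mod 3" by (simp add: mod_mod_cancel)
    moreover have "d div 2 mod 3 = d mod 6 div 2" using mod_mult2_eq[of d 2 3] by simp
    ultimately show ?thesis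
      using mod_6_cases[of d] by (elim disjE) (simp_all add: chi3_def chi6_def)
  qed
  show "divisor_series chi6 $ n = (divisor_series chi3 + 2 * dilate (divisor_series chi3) 2) $ n"
  proof (cases "n = 0")
    case False
    then have "divisor_series chi6 $ n
        = (\<Sum>d | d dvd n. chi3 d) + 2 * (\<Sum>d | d dvd n. if 2 dvd d then chi3 (d div 2) else 0)"
      by (simp add: divisor_series_def * sum.distrib sum_distrib_left)
    also have "(\<Sum>d | d dvd n. if 2 dvd d then chi3 (d div 2) else 0)
        = dilate (divisor_series chi3) 2 $ n"
      using False by (subst sum_divisors_multiples) (auto simp: dilate_nth divisor_series_def)
    finally show ?thesis by (simp add: numeral_mult_fps_nth divisor_series_def)
  qed (simp add: divisor_series_nth_0 numeral_mult_fps_nth dilate_nth)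
qed

lemma lambert_a_square:
  "lambert_a * lambert_a = 1 + 12 * sigma_series - 36 * dilate sigma_series 3"
proof -
  let ?A = "divisor_series chi3"
  have "lambert_a * lambert_a = 1 + 12 * ?A + 12 * (3 * (?A * ?A))"
    by (simp add: lambert_a_def algebra_simps)
  then show ?thesis by (simp add: divisor_series_chi3_square)
qed

text \<open>Polarisation: L(q) + 2 L(q^2) has a known square by the \<open>chi6\<close> evaluation,
  and L(q)^2 and L(q^2)^2 are known, so the cross term 4 L(q) L(q^2) follows.\<close>

lemma lambert_a_mult_dilate_2:
  "lambert_a * dilate lambert_a 2
   = 1 + 6 * sigma_series - 12 * dilate sigma_series 2 + 18 * dilate sigma_series 3
     - 36 * dilate sigma_series 6"
proof -
  let ?B = "divisor_series chi6" and ?S = "dilate sigma_series"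
  have "lambert_a + 2 * dilate lambert_a 2 = 3 + 6 * ?B"
    by (simp add: lambert_a_def divisor_series_chi6 dilate_simps algebra_simps)
  then have "(lambert_a + 2 * dilate lambert_a 2) * (lambert_a + 2 * dilate lambert_a 2)
      = 9 + 36 * ?B + 12 * (3 * (?B * ?B))"
    by (simp add: algebra_simps)
  also have "\<dots> = 9 + 36 * sigma_series + 36 * ?S 3 - 288 * ?S 6"
    unfolding divisor_series_chi6_square by (simp add: algebra_simps)
  finally have "4 * (lambert_a * dilate lambert_a 2)
      = 9 + 36 * sigma_series + 36 * ?S 3 - 288 * ?S 6
        - lambert_a * lambert_a - 4 * dilate (lambert_a * lambert_a) 2"
    by (simp add: algebra_simps dilate_simps)
  also have "\<dots> = 4 * (1 + 6 * sigma_series - 12 * ?S 2 + 18 * ?S 3 - 36 * ?S 6)"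
    unfolding lambert_a_square by (simp add: algebra_simps dilate_simps)
  finally show ?thesis by (simp only: mult_cancel_left) simp
qed

section \<open>Even parts and the quadratic relation for L\<close>

text \<open>For n = 2 m, the odd divisors of n are those of m and the even ones are 2 d with d | m.
  The sum over odd divisors of m is written as the full sum minus the even part.\<close>

lemma sum_divisors_even:
  fixes g :: "nat \<Rightarrow> int"
  assumes "n > 0" "even n"
  shows "(\<Sum>d | d dvd n. g d) = (\<Sum>d | d dvd n div 2. g d) + (\<Sum>d | d dvd n div 2. g (2 * d))
     - (if 4 dvd n then \<Sum>d | d dvd n div 4. g (2 * d) else 0)"
proof -
  let ?o = "\<lambda>n. \<Sum>d | d dvd n. if odd d then g d else 0"
  have split: "(\<Sum>d | d dvd m. g d) = ?o m + (\<Sum>d | d dvd m. if 2 dvd d then g d else 0)" for m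
    by (subst sum.distrib[symmetric]) (auto intro!: sum.cong)
  obtain m where m: "n = 2 * m" "m > 0" using assms by auto
  have odd_iff: "d dvd 2 * m \<and> odd d \<longleftrightarrow> d dvd m \<and> odd d" for d
    using coprime_dvd_mult_right_iff[of d 2 m] by auto
  have "?o n = (\<Sum>d | d dvd n \<and> odd d. g d)"
    using assms sum.inter_filter[of "{d. d dvd n}" g odd] by simp
  also have "\<dots> = (\<Sum>d | d dvd m \<and> odd d. g d)" unfolding m odd_iff ..
  also have "\<dots> = ?o m"
    using m sum.inter_filter[of "{d. d dvd m}" g odd] by simp
  finally have "?o n = ?o m" .
  moreover have "(\<Sum>d | d dvd n. if 2 dvd d then g d else 0) = (\<Sum>d | d dvd m. g (2 * d))"
    using assms(1) m by (subst sum_divisors_multiples) auto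
  moreover have "(\<Sum>d | d dvd m. if 2 dvd d then g d else 0)
      = (if 4 dvd n then \<Sum>d | d dvd n div 4. g (2 * d) else 0)"
  proof -
    have "4 dvd n \<longleftrightarrow> 2 dvd m" "n div 4 = m div 2" using m by presburger+
    then show ?thesis using m by (subst sum_divisors_multiples) auto
  qed
  ultimately show ?thesis using split[of n] split[of m] m by simp
qed

text \<open>Since chi3(2 d) = -chi3(d), the first two sums of \<open>sum_divisors_even\<close>
  cancel and the last gives the coefficient at n/4. This is the counterpart for L of a(q) = a(q^4) +
  6 X with X odd.\<close>

lemma lambert_a_even_part:
  assumes "even n"
  shows "lambert_a $ n = dilate lambert_a 4 $ n"
proof (cases "n = 0")
  case False
  have chi: "chi3 (2 * d) = - chi3 d" for d
  proof -
    have "2 * d mod 3 = (2 * (d mod 3)) mod 3" by (simp add: mod_mult_right_eq)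
    moreover have "d mod 3 \<in> {0, 1, 2}" by auto
    ultimately show ?thesis by (auto simp: chi3_def)
  qed
  have "divisor_series chi3 $ n = dilate (divisor_series chi3) 4 $ n"
    using sum_divisors_even[of n chi3] False assms
    by (simp add: divisor_series_def dilate_nth chi sum_negf)
  then show ?thesis using False
    by (simp add: lambert_a_def numeral_mult_fps_nth dilate_simps)
qed (simp add: dilate_nth)

lemma sigma_series_even_part:
  assumes "even n"
  shows "sigma_series $ n = 3 * dilate sigma_series 2 $ n - 2 * dilate sigma_series 4 $ n"
proof (cases "n = 0")
  case False
  then show ?thesis
    using sum_divisors_even[of n int] assms
    by (simp add: sigma_series_def divisor_series_def dilate_nth flip: sum_distrib_left)
qed (simp add: dilate_nth sigma_series_def divisor_series_nth_0)

text \<open>\<open>p\<close> and \<open>r\<close> encode the parity of the exponents carried by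
  \<open>f\<close> and \<open>g\<close>, \<open>True\<close> standing for even.\<close>

lemma fps_mult_nth_parity:
  fixes f g :: "int fps"
  assumes "\<And>i. even i \<noteq> p \<Longrightarrow> f $ i = 0" "\<And>i. even i \<noteq> r \<Longrightarrow> g $ i = 0" "even n \<noteq> (p = r)"
  shows "(f * g) $ n = 0"
  unfolding fps_mult_nth
proof (rule sum.neutral, rule ballI)
  fix i assume "i \<in> {0..n}"
  then have "even n \<longleftrightarrow> (even i \<longleftrightarrow> even (n - i))" using even_diff_nat[of n i] by auto
  then have "even i \<noteq> p \<or> even (n - i) \<noteq> r" using assms(3) by auto
  then show "f $ i * g $ (n - i) = 0" using assms(1)[of i] assms(2)[of "n - i"] by auto
qed

text \<open>In L(q) = L(q^4) + D the second summand is odd, so the even part of E(q) = L(q)^2 is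
  L(q^4)^2 + D^2. Because sigma(2 m) = 3 sigma(m) - 2 sigma(m/2), that even part is also 3 E(q^2) -
  2 E(q^4), where the constant term fits as 1 = 3 - 2.\<close>

lemma lambert_a_relation:
  "(lambert_a - dilate lambert_a 4) * (lambert_a - dilate lambert_a 4)
   = 3 * (dilate lambert_a 2 * dilate lambert_a 2) - 3 * (dilate lambert_a 4 * dilate lambert_a 4)"
proof -
  let ?L = "dilate lambert_a" and ?E = "lambert_a * lambert_a" and ?S = "dilate sigma_series"
  define D where "D = lambert_a - ?L 4"
  have D: "D $ i = 0" if "even i" for i
    using lambert_a_even_part[OF that] by (simp add: D_def)
  have L4: "?L 4 $ i = 0" if "odd i" for i
    using that by (auto simp: dilate_nth)
  have E: "?E = ?L 4 * ?L 4 + 2 * (?L 4 * D) + D * D"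
    by (simp add: D_def algebra_simps)
  have "(?L 4 * ?L 4 + D * D) $ n = (3 * dilate ?E 2 - 2 * dilate ?E 4) $ n" for n
  proof (cases "even n")
    case True
    have "(?L 4 * D) $ n = 0"
      by (rule fps_mult_nth_parity[of True _ False]) (use True L4 D in auto)
    then have "(?L 4 * ?L 4 + D * D) $ n = ?E $ n"
      unfolding E by (simp add: numeral_mult_fps_nth)
    also have "\<dots> = (1 + 12 * sigma_series - 36 * ?S 3) $ n" unfolding lambert_a_square ..
    also have "\<dots> = (1 :: int fps) $ n + 12 * (3 * ?S 2 $ n - 2 * ?S 4 $ n) - 36 * (3 * ?S 6 $ n
        - 2 * ?S 12 $ n)"
    proof -
      have "?S 3 $ n = 3 * ?S 6 $ n - 2 * ?S 12 $ n"
      proof (cases "3 dvd n")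
        case True
        then obtain m where m: "n = 3 * m" by blast
        have "even m" using \<open>even n\<close> m by simp
        have "?S 6 = dilate (?S 2) 3" "?S 12 = dilate (?S 4) 3" by (simp_all add: dilate_simps)
        then show ?thesis using sigma_series_even_part[OF \<open>even m\<close>] by (simp add: dilate_nth m)
      next
        case False
        then have "\<not> 6 dvd n" "\<not> 12 dvd n" by presburger+
        then show ?thesis using False by (simp add: dilate_nth)
      qed
      then show ?thesis by (simp add: sigma_series_even_part[OF True] numeral_mult_fps_nth)
    qed
    also have "\<dots> = (3 * dilate ?E 2 - 2 * dilate ?E 4) $ n"
      unfolding lambert_a_square
      by (simp add: dilate_simps numeral_mult_fps_nth)
    finally show ?thesis .
  next
    case False
    have "(?L 4 * ?L 4) $ n = 0"
      by (rule fps_mult_nth_parity[of True _ True]) (use False L4 in auto)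
    moreover have "(D * D) $ n = 0"
      by (rule fps_mult_nth_parity[of False _ False]) (use False D in auto)
    moreover have "dilate ?E 2 $ n = 0" "dilate ?E 4 $ n = 0"
      using False by (auto simp: dilate_nth)
    ultimately show ?thesis by (simp add: numeral_mult_fps_nth)
  qed
  then have "?L 4 * ?L 4 + D * D = 3 * dilate ?E 2 - 2 * dilate ?E 4" by (rule fps_ext)
  then show ?thesis unfolding D_def[symmetric]
    by (simp add: dilate_simps algebra_simps)
qed

text \<open>Four times the previous relation at q^2 expresses 16 L(q^8)^2 - 8 L(q^2) L(q^8) as 12
  L(q^4)^2 - 4 L(q^2)^2; substituting this makes both sides 3 L(q^2)^2 - 3 L(q^4)^2.\<close>

lemma borwein_relation_lambert_a: "borwein_relation lambert_a"
proof -
  let ?L = "dilate lambert_a"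
  have "(?L 2 - ?L 8) * (?L 2 - ?L 8) = 3 * (?L 4 * ?L 4) - 3 * (?L 8 * ?L 8)"
    using arg_cong[OF lambert_a_relation, of "\<lambda>f. dilate f 2"] by (simp add: dilate_simps)
  then have "4 * ((?L 2 - ?L 8) * (?L 2 - ?L 8)) = 4 * (3 * (?L 4 * ?L 4) - 3 * (?L 8 * ?L 8))"
    by simp
  then show ?thesis
    unfolding borwein_relation_def lambert_a_relation by (simp add: algebra_simps)
qed

text \<open>By rigidity it suffices that both series begin 1 + 6 q. For a the 6 comes from 6 X,
  whose first coefficient is 1 because psi has constant term 1.\<close>

lemma borwein_a_eq_lambert_a: "borwein_a = lambert_a"
proof (rule borwein_relation_unique[OF borwein_relation_borwein_a borwein_relation_lambert_a])
  have "{p. eisenstein_form p = 0} = {(0, 0)}"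
  proof -
    have "x = 0 \<and> y = 0" if "x\<^sup>2 + x * y + y\<^sup>2 = 0" for x y :: int
    proof -
      have "x\<^sup>2 + y\<^sup>2 + (x + y)\<^sup>2 = 0"
        using that by (simp add: power2_eq_square algebra_simps)
      then show ?thesis
        by (smt (verit) power2_less_eq_zero_iff zero_le_power2)
    qed
    then have "x = 0 \<and> y = 0" if "eisenstein_form (x, y) = 0" for x y
      using that unfolding eisenstein_form_def split_conv by blast
    moreover have "eisenstein_form (0, 0) = 0" by (simp add: eisenstein_form_def)
    ultimately show ?thesis by fast
  qed
  then show "borwein_a $ 0 = lambert_a $ 0"
    by (simp add: borwein_a_def count_series_def lambert_a_def divisor_series_nth_0)
  have *: "x = 0" if "x * (x + 1) div 2 = 0" "0 \<le> x" for x :: int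
  proof (rule ccontr)
    assume "x \<noteq> 0"
    then have "1 * 2 \<le> x * (x + 1)" using that(2) by (intro mult_mono) auto
    then show False using that(1) by linarith
  qed
  have "{x \<in> {0..}. x * (x + 1) div 2 = (0::int)} = {0}"
  proof (intro equalityI subsetI)
    fix x :: int assume "x \<in> {x \<in> {0..}. x * (x + 1) div 2 = 0}"
    then show "x \<in> {0}" using *[of x] by simp
  qed simp
  then have "theta_psi $ 0 = 1" by (simp add: theta_psi_def count_series_def)
  then have "theta_X $ 1 = 1" by (simp add: theta_X_def dilate_nth)
  then have a1: "borwein_a $ 1 = 6"
    by (subst borwein_a_dissection(1), unfold fps_add_nth numeral_mult_fps_nth)
       (simp add: dilate_nth)
  have "{d::nat. d dvd 1} = {1}" by auto
  then have "lambert_a $ 1 = 6"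
    unfolding lambert_a_def fps_add_nth numeral_mult_fps_nth
    by (simp add: divisor_series_def chi3_def)
  then show "borwein_a $ 1 = lambert_a $ 1" "borwein_a $ 1 \<noteq> 0" using a1 by simp_all
qed

section \<open>Gauss' product formulas\<close>

definition euler_prod :: "complex \<Rightarrow> complex" where
  "euler_prod q = (\<Prod>m. 1 - q ^ Suc m)"

lemma norm_power_less_one: "norm (q::complex) < 1 \<Longrightarrow> k > 0 \<Longrightarrow> norm (q ^ k) < 1"
  by (simp add: norm_power power_less_one_iff)

lemma power_neq_one: "norm (q::complex) < 1 \<Longrightarrow> k > 0 \<Longrightarrow> q ^ k \<noteq> 1"
  by (metis norm_one less_irrefl norm_power_less_one)

lemma one_plus_power_neq_zero: "norm (q::complex) < 1 \<Longrightarrow> k > 0 \<Longrightarrow> 1 + q ^ k \<noteq> 0"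
  using norm_power_less_one[of q k] by (auto simp: add_eq_0_iff)

lemma convergent_prod_euler:
  assumes "norm (q::complex) < 1"
  shows "convergent_prod (\<lambda>m. 1 - q ^ Suc m)"
proof -
  have "summable (\<lambda>m. norm (1 - q ^ Suc m - 1))"
    using summable_mult[OF summable_geometric[of "norm q"], of "norm q"] assms
    by (simp add: norm_mult norm_power)
  then have "abs_convergent_prod (\<lambda>m. 1 - q ^ Suc m)"
    by (rule summable_imp_abs_convergent_prod)
  then show ?thesis by (rule abs_convergent_prod_imp_convergent_prod)
qed

lemma euler_prod_nonzero: "norm (q::complex) < 1 \<Longrightarrow> euler_prod q \<noteq> 0"
  unfolding euler_prod_def
  by (rule prodinf_nonzero[OF convergent_prod_euler])
     (use power_neq_one[of q "Suc _"] in auto)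

lemma euler_prod_LIMSEQ:
  assumes "norm (q::complex) < 1"
  shows "(\<lambda>n. \<Prod>k=1..n. 1 - q ^ k) \<longlonglongrightarrow> euler_prod q"
proof -
  have "(\<lambda>n. \<Prod>k\<le>n. 1 - q ^ Suc k) \<longlonglongrightarrow> euler_prod q"
    unfolding euler_prod_def using convergent_prod_LIMSEQ[OF convergent_prod_euler[OF assms]] .
  also have "(\<lambda>n. \<Prod>k\<le>n. 1 - q ^ Suc k) = (\<lambda>n. \<Prod>k=1..Suc n. 1 - q ^ k)"
    by (simp add: prod.atLeast_Suc_atMost_Suc_shift atMost_atLeast0 del: prod.cl_ivl_Suc power_Suc)
  finally show ?thesis by (rule LIMSEQ_imp_Suc)
qed

text \<open>Shanks' finite form of Gauss' identity for triangular numbers; as \<open>n\<close> grows, only the term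
  \<open>s = 0\<close> on the right-hand side survives.\<close>

lemma shanks_triangular:
  fixes q :: complex
  assumes "norm q < 1"
  defines "P \<equiv> \<lambda>n. \<Prod>k=1..n. (1 - q ^ (2 * k)) / (1 - q ^ (2 * k - 1))"
  shows "(\<Sum>s<2 * n. q ^ (s * (s + 1) div 2)) = (\<Sum>s<n. P n / P s * q ^ (s * (2 * n + 1)))"
proof (induction n)
  case (Suc n)
  have ne: "1 - q ^ k \<noteq> 0" if "k > 0" for k using power_neq_one[OF assms(1) that] by simp
  have P_Suc: "P (Suc s) = P s * ((1 - q ^ (2 * s + 2)) / (1 - q ^ (2 * s + 1)))" for s
    by (simp add: P_def)
  have P_ne: "P s \<noteq> 0" for s
    unfolding P_def by (auto simp: power_neq_one[OF assms(1)])
  \<comment> \<open>A telescoping certificate of Wilf-Zeilberger type for the increment in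
    \<open>n\<close>: minus the summand times (1 - q^(2 s))/(1 - q^(2 n + 1)), vanishing at s =
    0.\<close>
  define G where "G = (\<lambda>s. - (P n / P s) * q ^ (s * (2 * n + 1)) * (1 - q ^ (2 * s)) / (1
      - q ^ (2 * n + 1)))"
  have step: "P (Suc n) / P s * q ^ (s * (2 * Suc n + 1)) - P n / P s * q ^ (s * (2 * n + 1))
      = G s - G (Suc s)" for s
  proof -
    define A B C where "A = q ^ (s * (2 * n + 1))" and "B = q ^ (2 * s)" and "C = q ^ (2 * n + 1)"
    have e: "q ^ (s * (2 * Suc n + 1)) = A * B" "q ^ (Suc s * (2 * n + 1)) = A * C"
       "q ^ (2 * Suc s) = B * q\<^sup>2" "q ^ (2 * s + 1) = B * q" "q ^ (2 * s + 2) = B * q\<^sup>2"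
       "q ^ (2 * n + 2) = C * q"
      by (simp_all add: A_def B_def C_def power_add[symmetric] algebra_simps power2_eq_square
         flip: power_Suc)
    have n0: "1 - C \<noteq> 0" "1 - B * q\<^sup>2 \<noteq> 0" "1 - B * q \<noteq> 0"
      using ne[of "2 * n + 1"] ne[of "2 * s + 2"] ne[of "2 * s + 1"] unfolding e C_def by simp_all
    have "P (Suc n) / P s * (A * B) - P n / P s * A
       = - (P n / P s) * A * (1 - B) / (1 - C) + (P n / P (Suc s)) * (A * C) * (1 - B
           * q\<^sup>2) / (1 - C)"
      unfolding P_Suc e C_def[symmetric] using n0 P_ne[of s]
      by (simp add: divide_simps) (simp add: algebra_simps power2_eq_square)
    then show ?thesis unfolding G_def e A_def[symmetric] B_def[symmetric] C_def[symmetric] by simp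
  qed
  have "(\<Sum>s<Suc n. P (Suc n) / P s * q ^ (s * (2 * Suc n + 1)))
      = (\<Sum>s<n. P n / P s * q ^ (s * (2 * n + 1)))
        + ((\<Sum>s<n. P (Suc n) / P s * q ^ (s * (2 * Suc n + 1)) - P n / P s * q ^ (s * (2 * n + 1)))
        + P (Suc n) / P n * q ^ (n * (2 * Suc n + 1)))"
    by (simp add: sum_subtractf)
  also have "(\<Sum>s<n. P (Suc n) / P s * q ^ (s * (2 * Suc n + 1)) - P n / P s * q ^ (s * (2 * n + 1)))
      = G 0 - G n"
    unfolding step by (rule sum_lessThan_telescope')
  \<comment> \<open>The boundary leaves q^T for the triangular numbers T of index 2 n and 2 n + 1,
    the two new terms of the left-hand sum.\<close>
  also have "G 0 - G n + P (Suc n) / P n * q ^ (n * (2 * Suc n + 1))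
      = q ^ (n * (2 * n + 1)) * (1 + q ^ (2 * n + 1))"
  proof -
    define A B where "A = q ^ (n * (2 * n + 1))" and "B = q ^ (2 * n)"
    have e: "q ^ (n * (2 * Suc n + 1)) = A * B" "q ^ (2 * n + 1) = B * q" "q ^ (2 * n + 2)
        = B * q\<^sup>2"
      by (simp_all add: A_def B_def power_add[symmetric] algebra_simps power2_eq_square
         flip: power_Suc)
    have n0: "1 - B * q \<noteq> 0" using ne[of "2 * n + 1"] unfolding e by simp
    have "A * (1 - B) / (1 - B * q) + (1 - B * q\<^sup>2) / (1 - B * q) * (A * B) = A * (1 + B * q)"
      using n0 by (simp add: divide_simps) (simp add: algebra_simps power2_eq_square)
    then show ?thesis
      unfolding G_def P_Suc e A_def[symmetric] B_def[symmetric] using P_ne[of n] by simp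
  qed
  finally have "(\<Sum>s<Suc n. P (Suc n) / P s * q ^ (s * (2 * Suc n + 1)))
      = (\<Sum>s<2 * n. q ^ (s * (s + 1) div 2)) + q ^ (n * (2 * n + 1)) * (1 + q ^ (2 * n + 1))"
    unfolding Suc.IH .
  moreover have "(\<Sum>s<2 * Suc n. q ^ (s * (s + 1) div 2)) = (\<Sum>s<2 * n. q ^ (s * (s + 1) div 2))
      + q ^ (n * (2 * n + 1)) * (1 + q ^ (2 * n + 1))"
  proof -
    have e: "2 * n * (2 * n + 1) div 2 = n * (2 * n + 1)"
      "(2 * n + 1) * (2 * n + 1 + 1) div 2 = n * (2 * n + 1) + (2 * n + 1)"
      by (simp_all add: algebra_simps)
    have "(\<Sum>s<2 * Suc n. h s) = (\<Sum>s<2 * n. h s) + (h (2 * n) + h (2 * n + 1))"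
      for h :: "nat \<Rightarrow> complex"
      by simp
    moreover have "q ^ a * (1 + q ^ b) = q ^ a + q ^ (a + b)" for a b
      by (simp add: distrib_left power_add)
    ultimately show ?thesis by (simp only: e)
  qed
  ultimately show ?case by simp
qed simp

text \<open>The companion for squares, again by telescoping in \<open>n\<close>. The term s = 0 is
  \<open>P n\<close>, its factor 2 being cancelled by 1 + q^0.\<close>

lemma shanks_square:
  fixes q :: complex
  assumes "norm q < 1"
  defines "P \<equiv> \<lambda>n. \<Prod>k=1..n. (1 - q ^ k) / (1 + q ^ k)"
  shows "1 + 2 * (\<Sum>s=1..n. (- 1) ^ s * q ^ s\<^sup>2)
    = (\<Sum>s\<le>n. 2 * (- 1) ^ s * (P n / P s) * q ^ (s * (n + 1)) / (1 + q ^ s))"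
proof (induction n)
  case 0
  show ?case by (simp add: P_def)
next
  case (Suc n)
  let ?t = "\<lambda>n s. 2 * (- 1) ^ s * (P n / P s) * q ^ (s * (n + 1)) / (1 + q ^ s)"
  have ne: "1 - q ^ k \<noteq> 0" if "k > 0" for k using power_neq_one[OF assms(1) that] by simp
  have ne': "1 + q ^ k \<noteq> 0" for k
    using one_plus_power_neq_zero[OF assms(1), of k] by (cases "k = 0") auto
  have P_Suc: "P (Suc s) = P s * ((1 - q ^ Suc s) / (1 + q ^ Suc s))" for s
    by (simp add: P_def)
  have P_ne: "P s \<noteq> 0" for s
    unfolding P_def by (auto simp: power_neq_one[OF assms(1)] ne')
  \<comment> \<open>The certificate is now the summand times (1 - q^s)/(1 + q^(n + 1)), which
    vanishes at s = 0.\<close>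
  define G where "G = (\<lambda>s. 2 * (- 1) ^ s * (P n / P s) * q ^ (s * (n + 1)) * (1 - q ^ s)
    / ((1 + q ^ s) * (1 + q ^ Suc n)))"
  have step: "?t (Suc n) s - ?t n s = G (Suc s) - G s" for s
  proof -
    define A B C where "A = q ^ (s * (n + 1))" and "B = q ^ s" and "C = q ^ Suc n"
    have e: "q ^ (s * (Suc n + 1)) = A * B" "q ^ (Suc s * (n + 1)) = A * C" "q ^ Suc s = B * q"
      by (simp_all add: A_def B_def C_def power_add[symmetric] algebra_simps)
    have n0: "1 + C \<noteq> 0" "1 + B \<noteq> 0" "1 - B * q \<noteq> 0" "1 + B * q \<noteq> 0"
      using ne'[of "Suc n"] ne'[of s] ne[of "Suc s"] ne'[of "Suc s"]
          unfolding e C_def B_def by simp_all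
    have "2 * (- 1) ^ s * (P (Suc n) / P s) * (A * B) / (1 + B)
        - 2 * (- 1) ^ s * (P n / P s) * A / (1 + B)
       = 2 * (- 1) ^ Suc s * (P n / P (Suc s)) * (A * C) * (1 - B * q) / ((1 + B * q) * (1 + C))
        - 2 * (- 1) ^ s * (P n / P s) * A * (1 - B) / ((1 + B) * (1 + C))"
      unfolding P_Suc e C_def[symmetric] using n0 P_ne[of s]
      by (simp add: divide_simps) (simp add: algebra_simps)
    then show ?thesis unfolding G_def e A_def[symmetric] B_def[symmetric] C_def[symmetric] by simp
  qed
  have "(\<Sum>s\<le>Suc n. ?t (Suc n) s)
      = (\<Sum>s\<le>n. ?t n s) + (\<Sum>s<Suc n. ?t (Suc n) s - ?t n s) + ?t (Suc n) (Suc n)"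
    by (simp add: sum_subtractf lessThan_Suc_atMost)
  also have "(\<Sum>s<Suc n. ?t (Suc n) s - ?t n s) = G (Suc n) - G 0"
    unfolding step by (rule sum_lessThan_telescope)
  also have "(\<Sum>s\<le>n. ?t n s) + (G (Suc n) - G 0) + ?t (Suc n) (Suc n)
      = (\<Sum>s\<le>n. ?t n s) + 2 * ((- 1) ^ Suc n * q ^ (Suc n)\<^sup>2)"
  proof -
    define A C where "A = q ^ (Suc n)\<^sup>2" and "C = q ^ Suc n"
    have e: "q ^ (Suc n * (Suc n + 1)) = A * C" "q ^ (Suc n * (n + 1)) = A"
      by (simp_all add: A_def C_def power_add[symmetric] power2_eq_square algebra_simps)
    have n0: "1 + C \<noteq> 0" "1 - C \<noteq> 0" using ne'[of "Suc n"] ne[of "Suc n"]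
        unfolding C_def by simp_all
    have G0: "G 0 = 0" by (simp add: G_def)
    have "G (Suc n) = 2 * (- 1) ^ Suc n * A / (1 + C)"
      unfolding G_def e C_def[symmetric] P_Suc using n0 P_ne[of n] by (simp add: divide_simps)
    moreover have "?t (Suc n) (Suc n) = 2 * (- 1) ^ Suc n * (A * C) / (1 + C)"
      unfolding e C_def[symmetric] using n0 P_ne[of "Suc n"] by simp
    moreover have "2 * (- 1) ^ Suc n * A / (1 + C) + 2 * (- 1) ^ Suc n * (A * C) / (1 + C)
       = 2 * ((- 1) ^ Suc n * A)"
      using n0 by (simp add: divide_simps) (simp add: algebra_simps)
    ultimately show ?thesis unfolding A_def[symmetric] G0 by (simp only: add.assoc diff_0_right)
  qed
  finally show ?case unfolding Suc.IH[symmetric] by (simp add: algebra_simps)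
qed

text \<open>The term s = 0 of the finite identity is \<open>P n\<close>, which tends to the product;
  the other terms have exponents at least n and together are O(n |q|^n).\<close>

lemma gauss_triangular:
  fixes q :: complex
  assumes "norm q < 1"
  shows "(\<lambda>n. \<Sum>s<2 * n. q ^ (s * (s + 1) div 2)) \<longlonglongrightarrow> euler_prod (q\<^sup>2) ^ 2 / euler_prod q"
proof -
  define P where "P = (\<lambda>n. \<Prod>k=1..n. (1 - q ^ (2 * k)) / (1 - q ^ (2 * k - 1)))"
  have q2: "norm (q\<^sup>2) < 1" using norm_power_less_one[OF assms] by simp
  have ne: "1 - q ^ k \<noteq> 0" if "k > 0" for k using power_neq_one[OF assms(1) that] by simp
  \<comment> \<open>Filling up the odd factors in the denominator of \<open>P n\<close> with the
    even ones yields all factors up to 2 n.\<close>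
  have "(\<Prod>k=1..2 * n. 1 - q ^ k) * P n = (\<Prod>k=1..n. 1 - (q\<^sup>2) ^ k) ^ 2" for n
  proof (induction n)
    case (Suc n)
    have "(\<Prod>k=1..2 * Suc n. 1 - q ^ k) * P (Suc n)
        = ((\<Prod>k=1..2 * n. 1 - q ^ k) * P n) * (1 - q ^ (2 * Suc n)) ^ 2"
      using ne[of "2 * n + 1"] by (simp add: P_def power2_eq_square mult_ac)
    also have "\<dots> = (\<Prod>k=1..n. 1 - (q\<^sup>2) ^ k) ^ 2 * (1 - (q\<^sup>2) ^ Suc n) ^ 2"
      unfolding Suc.IH power_mult ..
    finally show ?case by (simp add: power_mult_distrib)
  qed (simp add: P_def)
  then have P_eq: "P = (\<lambda>n. (\<Prod>k=1..n. 1 - (q\<^sup>2) ^ k) ^ 2 / (\<Prod>k=1..2 * n. 1 - q ^ k))"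
    by (intro ext) (subst nonzero_eq_divide_eq, auto simp: power_neq_one[OF assms] mult.commute)
  have "(\<lambda>n. \<Prod>k=1..2 * n. 1 - q ^ k) \<longlonglongrightarrow> euler_prod q"
    using LIMSEQ_subseq_LIMSEQ[OF euler_prod_LIMSEQ[OF assms], of "\<lambda>n. 2 * n"]
    by (simp add: strict_mono_def o_def)
  then have P_lim: "P \<longlonglongrightarrow> euler_prod (q\<^sup>2) ^ 2 / euler_prod q"
    unfolding P_eq using euler_prod_LIMSEQ[OF q2] euler_prod_nonzero[OF assms]
    by (intro tendsto_intros)
  have lim_ne: "euler_prod (q\<^sup>2) ^ 2 / euler_prod q \<noteq> 0"
    using euler_prod_nonzero[OF q2] euler_prod_nonzero[OF assms] by simp
  \<comment> \<open>The limit is nonzero, so \<open>P\<close> and its inverse are both bounded, and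
    the ratios \<open>P n / P s\<close> are bounded uniformly.\<close>
  have "Bseq P" using P_lim by (intro convergent_imp_Bseq) (auto simp: convergent_def)
  then obtain B where B: "\<And>n. norm (P n) \<le> B" by (auto simp: Bseq_def)
  have "Bseq (\<lambda>n. inverse (P n))"
    using tendsto_inverse[OF P_lim lim_ne]
        by (intro convergent_imp_Bseq) (auto simp: convergent_def)
  then obtain B' where B': "\<And>n. norm (inverse (P n)) \<le> B'" by (auto simp: Bseq_def)
  let ?r = "\<lambda>n. \<Sum>s\<in>{1..<n}. P n / P s * q ^ (s * (2 * n + 1))"
  have bnd: "norm (?r n) \<le> B * B' * (real n * norm q ^ n)" for n
  proof -
    have "norm (?r n) \<le> (\<Sum>s\<in>{1..<n}. B * B' * norm q ^ n)"
    proof (rule sum_norm_le)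
      fix s assume "s \<in> {1..<n}"
      then have "1 * n \<le> s * (2 * n + 1)" by (intro mult_mono) auto
      then have "norm q ^ (s * (2 * n + 1)) \<le> norm q ^ n"
        using assms by (intro power_decreasing) auto
      then show "norm (P n / P s * q ^ (s * (2 * n + 1))) \<le> B * B' * norm q ^ n"
        unfolding divide_inverse norm_mult norm_power
        using B[of n] B'[of s] order_trans[OF norm_ge_zero B[of 0]] order_trans[OF
            norm_ge_zero B'[of 0]]
        by (intro mult_mono) auto
    qed
    also have "\<dots> \<le> real n * (B * B' * norm q ^ n)"
      using order_trans[OF norm_ge_zero B[of 0]] order_trans[OF norm_ge_zero B'[of 0]]
      by (simp, intro mult_right_mono) auto
    finally show ?thesis by (simp add: mult_ac)
  qed
  have "(\<lambda>n. B * B' * (real n * norm q ^ n)) \<longlonglongrightarrow> B * B' * 0"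
    using powser_times_n_limit_0[of "norm q"] assms by (intro tendsto_mult tendsto_const) auto
  then have "(\<lambda>n. B * B' * (real n * norm q ^ n)) \<longlonglongrightarrow> 0" by simp
  then have r: "?r \<longlonglongrightarrow> 0" by (rule Lim_null_comparison[rotated]) (use bnd in auto)
  have "(\<lambda>n. P n + ?r n) \<longlonglongrightarrow> euler_prod (q\<^sup>2) ^ 2 / euler_prod q + 0"
    by (intro tendsto_add P_lim r)
  moreover have "eventually (\<lambda>n. P n + ?r n = (\<Sum>s<2 * n. q ^ (s * (s + 1) div 2))) sequentially"
    using eventually_gt_at_top[of 0]
  proof eventually_elim
    case (elim n)
    have "{..<n} = insert 0 {1..<n}" using elim by auto
    then have "(\<Sum>s<n. P n / P s * q ^ (s * (2 * n + 1))) = P n + ?r n" by (simp add: P_def)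
    then show ?case using shanks_triangular[OF assms, of n] by (simp add: P_def)
  qed
  ultimately show ?thesis by (auto intro: Lim_transform_eventually)
qed

text \<open>As for triangular numbers, with (1 - q^k)/(1 + q^k) = (1 - q^k)^2/(1 - q^(2 k)) giving
  the limit. The extra denominator 1 + q^s is at least 1 - |q| in absolute value for s \<ge>
  1.\<close>

lemma gauss_square:
  fixes q :: complex
  assumes "norm q < 1"
  shows "(\<lambda>n. 1 + 2 * (\<Sum>s=1..n. (- 1) ^ s * q ^ s\<^sup>2)) \<longlonglongrightarrow> euler_prod q ^ 2 / euler_prod (q\<^sup>2)"
proof -
  define P where "P = (\<lambda>n. \<Prod>k=1..n. (1 - q ^ k) / (1 + q ^ k))"
  have q2: "norm (q\<^sup>2) < 1" using norm_power_less_one[OF assms] by simp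
  have ne: "1 - q ^ k \<noteq> 0" if "k > 0" for k using power_neq_one[OF assms(1) that] by simp
  have ne': "1 + q ^ k \<noteq> 0" for k
    using one_plus_power_neq_zero[OF assms(1), of k] by (cases "k = 0") auto
  have P_eq: "P = (\<lambda>n. (\<Prod>k=1..n. 1 - q ^ k) ^ 2 / (\<Prod>k=1..n. 1 - (q\<^sup>2) ^ k))"
  proof
    fix n
    have "(1 - q ^ k) / (1 + q ^ k) = (1 - q ^ k) ^ 2 / (1 - (q\<^sup>2) ^ k)" if "k > 0" for k
    proof -
      have "1 - (q\<^sup>2) ^ k = (1 - q ^ k) * (1 + q ^ k)"
        by (simp add: algebra_simps power2_eq_square power_mult_distrib)
      then show ?thesis using ne[OF that] by (simp add: power2_eq_square)
    qed
    then show "P n = (\<Prod>k=1..n. 1 - q ^ k) ^ 2 / (\<Prod>k=1..n. 1 - (q\<^sup>2) ^ k)"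
      by (simp add: P_def prod_power_distrib prod_dividef[symmetric])
  qed
  have P_lim: "P \<longlonglongrightarrow> euler_prod q ^ 2 / euler_prod (q\<^sup>2)"
    unfolding P_eq using euler_prod_LIMSEQ[OF q2] euler_prod_LIMSEQ[OF assms]
        euler_prod_nonzero[OF q2]
    by (intro tendsto_intros)
  have lim_ne: "euler_prod q ^ 2 / euler_prod (q\<^sup>2) \<noteq> 0"
    using euler_prod_nonzero[OF q2] euler_prod_nonzero[OF assms] by simp
  have "Bseq P" using P_lim by (intro convergent_imp_Bseq) (auto simp: convergent_def)
  then obtain B where B: "\<And>n. norm (P n) \<le> B" by (auto simp: Bseq_def)
  have "Bseq (\<lambda>n. inverse (P n))"
    using tendsto_inverse[OF P_lim lim_ne]
        by (intro convergent_imp_Bseq) (auto simp: convergent_def)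
  then obtain B' where B': "\<And>n. norm (inverse (P n)) \<le> B'" by (auto simp: Bseq_def)
  have nq: "0 < 1 - norm q" using assms by simp
  define K where "K = 2 * B * B' / (1 - norm q)"
  let ?t = "\<lambda>n s. 2 * (- 1) ^ s * (P n / P s) * q ^ (s * (n + 1)) / (1 + q ^ s)"
  let ?r = "\<lambda>n. \<Sum>s=1..n. ?t n s"
  have bnd: "norm (?r n) \<le> K * (real n * norm q ^ n)" for n
  proof -
    have "norm (?r n) \<le> (\<Sum>s=1..n. K * norm q ^ n)"
    proof (rule sum_norm_le)
      fix s assume s: "s \<in> {1..n}"
      then have "1 * n \<le> s * (n + 1)" by (intro mult_mono) auto
      then have *: "norm q ^ (s * (n + 1)) \<le> norm q ^ n"
        using assms by (intro power_decreasing) auto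
      have "norm q ^ s \<le> norm q ^ 1" using assms s by (intro power_decreasing) auto
      then have "1 - norm q \<le> 1 - norm (q ^ s)" by (simp add: norm_power)
      also have "\<dots> \<le> norm (1 + q ^ s)" using norm_diff_ineq[of 1 "q ^ s"] by simp
      finally have inv: "inverse (norm (1 + q ^ s)) \<le> inverse (1 - norm q)"
        using nq by (intro le_imp_inverse_le) auto
      have "norm (?t n s) = 2 * (norm (P n) * norm (inverse (P s))) * norm q ^ (s * (n + 1))
          * inverse (norm (1 + q ^ s))"
        by (simp add: norm_mult norm_divide norm_power divide_inverse norm_inverse)
      also have "\<dots> \<le> 2 * (B * B') * norm q ^ n * inverse (1 - norm q)"
        using B[of n] B'[of s] * inv order_trans[OF norm_ge_zero B[of 0]] order_trans[OF
            norm_ge_zero B'[of 0]]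
        by (intro mult_mono) (auto simp del: norm_inverse)
      also have "\<dots> = K * norm q ^ n" by (simp add: K_def divide_inverse)
      finally show "norm (?t n s) \<le> K * norm q ^ n" .
    qed
    then show ?thesis by (simp add: mult_ac)
  qed
  have "(\<lambda>n. K * (real n * norm q ^ n)) \<longlonglongrightarrow> K * 0"
    using powser_times_n_limit_0[of "norm q"] assms by (intro tendsto_mult tendsto_const) auto
  then have "(\<lambda>n. K * (real n * norm q ^ n)) \<longlonglongrightarrow> 0" by simp
  then have r: "?r \<longlonglongrightarrow> 0" by (rule Lim_null_comparison[rotated]) (use bnd in auto)
  have "(\<lambda>n. P n + ?r n) \<longlonglongrightarrow> euler_prod q ^ 2 / euler_prod (q\<^sup>2) + 0"
    by (intro tendsto_add P_lim r)
  moreover have "P n + ?r n = 1 + 2 * (\<Sum>s=1..n. (- 1) ^ s * q ^ s\<^sup>2)" for n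
  proof -
    have "{..n} = insert 0 {1..n}" by auto
    then have "(\<Sum>s\<le>n. ?t n s) = P n + ?r n" by (simp add: P_def)
    then show ?thesis using shanks_square[OF assms, of n] by (simp add: P_def)
  qed
  ultimately show ?thesis by simp
qed

section \<open>The eta quotients\<close>

text \<open>Absolute convergence is part of the notion so that Cauchy products can be
  formed.\<close>

definition evaluates :: "int fps \<Rightarrow> complex \<Rightarrow> complex \<Rightarrow> bool" where
  "evaluates f q v \<longleftrightarrow> summable (\<lambda>n. norm (of_int (f $ n) * q ^ n))
     \<and> (\<lambda>n. of_int (f $ n) * q ^ n) sums v"

lemma evaluates_mult:
  assumes "evaluates f q v" "evaluates g q w"
  shows "evaluates (f * g) q (v * w)"
proof -
  let ?a = "\<lambda>n. of_int (f $ n) * q ^ n" and ?b = "\<lambda>n. of_int (g $ n) * q ^ n"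
  have a: "summable (\<lambda>n. norm (?a n))" "suminf ?a
      = v" and b: "summable (\<lambda>n. norm (?b n))" "suminf ?b = w"
    using assms by (auto simp: evaluates_def sums_iff)
  have eq: "of_int ((f * g) $ n) * q ^ n = (\<Sum>i\<le>n. ?a i * ?b (n - i))" for n
  proof -
    have "of_int ((f * g) $ n) * q ^ n = (\<Sum>i\<le>n. of_int (f $ i) * of_int (g $ (n - i)) * q ^ n)"
      by (simp add: fps_mult_nth atMost_atLeast0 sum_distrib_right)
    also have "\<dots> = (\<Sum>i\<le>n. ?a i * ?b (n - i))"
    proof (rule sum.cong)
      fix i assume "i \<in> {..n}"
      then have "q ^ n = q ^ i * q ^ (n - i)" by (simp flip: power_add)
      then show "of_int (f $ i) * of_int (g $ (n - i)) * q ^ n = ?a i * ?b (n - i)" by simp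
    qed simp
    finally show ?thesis .
  qed
  have "summable (\<lambda>n. \<Sum>i\<le>n. norm (?a i) * norm (?b (n - i)))"
    by (rule summable_Cauchy_product) (use a b in simp_all)
  then have "summable (\<lambda>n. norm (\<Sum>i\<le>n. ?a i * ?b (n - i)))"
    by (rule summable_comparison_test'[where N = 0])
       (auto intro!: sum_norm_le simp: norm_mult)
  moreover have "(\<lambda>n. \<Sum>i\<le>n. ?a i * ?b (n - i)) sums (v * w)"
    using Cauchy_product_sums[OF a(1) b(1)] unfolding a(2) b(2) .
  ultimately show ?thesis unfolding evaluates_def eq by blast
qed

lemma evaluates_dilate:
  assumes "k > 0" "evaluates f (q ^ k) v"
  shows "evaluates (dilate f k) q v"
proof -
  have mono: "strict_mono (\<lambda>n. k * n)" using assms(1) by (simp add: strict_mono_def)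
  have zero: "dilate f k $ n = 0" if "n \<notin> range (\<lambda>n. k * n)" for n
    using that assms(1) by (auto simp: dilate_nth elim!: dvdE)
  have eq: "of_int (dilate f k $ (k * n)) * q ^ (k * n) = of_int (f $ n) * (q ^ k) ^ n" for n
    using assms(1) by (simp add: dilate_nth power_mult)
  have "summable (\<lambda>n. norm (of_int (dilate f k $ n) * q ^ n))"
    by (subst summable_mono_reindex[OF mono, symmetric])
       (use zero assms(2) in \<open>auto simp: eq evaluates_def\<close>)
  moreover have "(\<lambda>n. of_int (dilate f k $ n) * q ^ n) sums v"
    by (subst sums_mono_reindex[OF mono, symmetric])
       (use zero assms(2) in \<open>auto simp: eq evaluates_def\<close>)
  ultimately show ?thesis by (simp add: evaluates_def)
qed

lemma evaluates_fps_X: "evaluates fps_X q q"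
proof -
  have eq: "of_int (fps_X $ n) * q ^ n = (if n = 1 then q else 0)" for n by simp
  have eq': "norm (if n = 1 then q else 0) = (if n = 1 then norm q else 0)" for n by simp
  show ?thesis unfolding evaluates_def eq unfolding eq'
    using sums_single[of 1 "\<lambda>_. q"] sums_single[of 1 "\<lambda>_. norm q"] by (auto simp: sums_iff)
qed

lemma summable_bounded_coeffs:
  assumes "norm q < 1" "\<And>n. \<bar>f $ n\<bar> \<le> C"
  shows "summable (\<lambda>n. norm (of_int (f $ n) * (q::complex) ^ n))"
proof (rule summable_comparison_test'[where N = 0])
  show "summable (\<lambda>n. of_int C * norm q ^ n)"
    using assms(1) by (intro summable_mult summable_geometric) simp
  fix n
  have "real_of_int \<bar>f $ n\<bar> \<le> of_int C" using assms(2)[of n] by (simp only: of_int_le_iff)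
  then show "norm (norm (of_int (f $ n) * q ^ n)) \<le> of_int C * norm q ^ n"
    by (simp add: norm_mult norm_power mult_right_mono)
qed

text \<open>For lacunary series: \<open>g\<close> lists the exponents. Bounded coefficients
  guarantee convergence, so the value can be read off from the partial sums of lengths
  \<open>r n\<close> alone.\<close>

lemma evaluatesI_subsequence:
  fixes g r :: "nat \<Rightarrow> nat"
  assumes q: "norm q < 1" and bound: "\<And>n. \<bar>f $ n\<bar> \<le> C" and g: "strict_mono g"
    and zero: "\<And>n. n \<notin> range g \<Longrightarrow> f $ n = 0" and r: "strict_mono r"
    and lim: "(\<lambda>n. \<Sum>s<r n. of_int (f $ g s) * q ^ g s) \<longlonglongrightarrow> v"
  shows "evaluates f q v"
proof -
  let ?h = "\<lambda>n. of_int (f $ n) * q ^ n"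
  have sm: "summable (\<lambda>n. norm (?h n))" by (rule summable_bounded_coeffs[OF q bound])
  then have "?h sums suminf ?h" by (rule summable_sums[OF summable_norm_cancel])
  then have "(\<lambda>s. ?h (g s)) sums suminf ?h"
    by (subst sums_mono_reindex[OF g]) (auto simp: zero)
  then have "(\<lambda>n. \<Sum>s<r n. ?h (g s)) \<longlonglongrightarrow> suminf ?h"
    unfolding sums_def using LIMSEQ_subseq_LIMSEQ[OF _ r] by (fastforce simp: o_def)
  then have "suminf ?h = v" using lim by (rule LIMSEQ_unique)
  then show ?thesis
    using sm \<open>?h sums suminf ?h\<close> by (simp add: evaluates_def)
qed

lemma theta_psi_nth:
  "theta_psi $ n = (if n \<in> range (\<lambda>s. s * (s + 1) div 2) then 1 else 0)"
  "strict_mono (\<lambda>s::nat. s * (s + 1) div 2)"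
proof -
  let ?t = "\<lambda>s::nat. s * (s + 1) div 2"
  have "?t s < ?t (Suc s)" for s by simp
  then show mono: "strict_mono ?t" by (rule strict_mono_Suc_iff[THEN iffD2, rule_format])
  have t: "int s * (int s + 1) div 2 = int (?t s)" for s
    by (simp add: zdiv_int algebra_simps)
  have "{x \<in> {0..}. x * (x + 1) div 2 = int n} = int ` {s. ?t s = n}"
  proof (intro equalityI subsetI)
    fix x assume x: "x \<in> {x \<in> {0..}. x * (x + 1) div 2 = int n}"
    then have "int (?t (nat x)) = int n" by (simp only: t[symmetric]) simp
    then have "?t (nat x) = n" by (simp only: of_nat_eq_iff)
    then show "x \<in> int ` {s. ?t s = n}" using x by (intro image_eqI[of _ _ "nat x"]) auto
  next
    fix x assume "x \<in> int ` {s. ?t s = n}"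
    then obtain s where "x = int s" "?t s = n" by blast
    then show "x \<in> {x \<in> {0..}. x * (x + 1) div 2 = int n}" using t[of s] by simp
  qed
  moreover have "card (int ` {s. ?t s = n}) = card {s. ?t s = n}"
    by (rule card_image) simp
  moreover have "card {s. ?t s = n} = (if n \<in> range ?t then 1 else 0)"
  proof (cases "n \<in> range ?t")
    case True
    then obtain s where "n = ?t s" by blast
    then have "{s. ?t s = n} = {s}" using strict_mono_eq[OF mono] by auto
    then show ?thesis using True by simp
  next
    case False
    then have "{s. ?t s = n} = {}" by blast
    then show ?thesis using False by (simp only: card.empty if_False)
  qed
  ultimately show "theta_psi $ n = (if n \<in> range ?t then 1 else 0)"
    unfolding theta_psi_def count_series_def fps_nth_Abs_fps by simp
qed

lemma evaluates_theta_psi: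
  assumes "norm q < 1"
  shows "evaluates theta_psi q (euler_prod (q\<^sup>2) ^ 2 / euler_prod q)"
proof (rule evaluatesI_subsequence[OF assms, where C = 1 and g = "\<lambda>s. s * (s + 1) div 2" and r
    = "\<lambda>n. 2 * n"])
  show "strict_mono (\<lambda>s::nat. s * (s + 1) div 2)" by (rule theta_psi_nth)
  have "(\<lambda>n. \<Sum>s<2 * n. of_int (theta_psi $ (s * (s + 1) div 2)) * q ^ (s * (s + 1) div 2))
      = (\<lambda>n. \<Sum>s<2 * n. q ^ (s * (s + 1) div 2))"
    by (simp add: theta_psi_nth(1))
  then show "(\<lambda>n. \<Sum>s<2 * n. of_int (theta_psi $ (s * (s + 1) div 2)) * q ^ (s * (s + 1) div 2))
      \<longlonglongrightarrow> euler_prod (q\<^sup>2) ^ 2 / euler_prod q"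
    using gauss_triangular[OF assms] by (simp only:)
qed (auto simp: theta_psi_nth(1) strict_mono_def)

lemma theta_phi_nth:
  "theta_phi $ s\<^sup>2 = (if s = 0 then 1 else 2)"
  "n \<notin> range (\<lambda>s. s\<^sup>2) \<Longrightarrow> theta_phi $ n = 0"
proof -
  have "{x::int. x\<^sup>2 = int (s\<^sup>2)} = {int s, - int s}"
    using power2_eq_iff[of _ "int s"] by auto
  then show "theta_phi $ s\<^sup>2 = (if s = 0 then 1 else 2)"
    by (simp add: theta_phi_def count_series_def)
  assume n: "n \<notin> range (\<lambda>s. s\<^sup>2)"
  have "x\<^sup>2 \<noteq> int n" for x :: int
  proof
    assume "x\<^sup>2 = int n"
    then have "int ((nat \<bar>x\<bar>)\<^sup>2) = int n" by simp
    then have "n = (nat \<bar>x\<bar>)\<^sup>2" by (simp only: of_nat_eq_iff)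
    then show False using n by blast
  qed
  then show "theta_phi $ n = 0" by (simp add: theta_phi_def count_series_def)
qed

lemma evaluates_theta_phi_minus:
  assumes "norm q < 1"
  shows "evaluates theta_phi_minus q (euler_prod q ^ 2 / euler_prod (q\<^sup>2))"
proof (rule evaluatesI_subsequence[OF assms, where C = 2 and g = "\<lambda>s. s\<^sup>2" and r = Suc])
  show "strict_mono (\<lambda>s::nat. s\<^sup>2)" by (auto simp: strict_mono_def power_strict_mono)
  show "theta_phi_minus $ n = 0" if "n \<notin> range (\<lambda>s. s\<^sup>2)" for n
    using theta_phi_nth(2)[OF that] by (simp add: theta_phi_minus_def fps_compose_uminus_X_nth)
  show "\<bar>theta_phi_minus $ n\<bar> \<le> 2" for n
  proof (cases "n \<in> range (\<lambda>s. s\<^sup>2)")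
    case True
    then show ?thesis
      by (auto simp: theta_phi_minus_def fps_compose_uminus_X_nth theta_phi_nth(1)
          abs_mult power_abs)
  next
    case False
    then show ?thesis
      using theta_phi_nth(2)[OF False] by (simp add: theta_phi_minus_def fps_compose_uminus_X_nth)
  qed
  \<comment> \<open>Since s^2 and s have the same parity, phi(-q) carries the signs of Gauss'
    formula.\<close>
  have sgn: "(- 1) ^ s\<^sup>2 = ((- 1) ^ s :: int)" for s :: nat
    by (cases "even s") auto
  have nth: "theta_phi_minus $ s\<^sup>2 = (if s = 0 then 1 else 2 * (- 1) ^ s)" for s
    by (simp add: theta_phi_minus_def fps_compose_uminus_X_nth theta_phi_nth(1) sgn)
  have "(\<Sum>s<Suc n. of_int (theta_phi_minus $ s\<^sup>2) * q ^ s\<^sup>2)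
      = 1 + 2 * (\<Sum>s=1..n. (- 1) ^ s * q ^ s\<^sup>2)" for n
  proof -
    have "{..<Suc n} = insert 0 {1..n}" by auto
    then have "(\<Sum>s<Suc n. of_int (theta_phi_minus $ s\<^sup>2) * q ^ s\<^sup>2)
        = 1 + (\<Sum>s=1..n. of_int (theta_phi_minus $ s\<^sup>2) * q ^ s\<^sup>2)"
      using nth[of 0] by simp
    also have "(\<Sum>s=1..n. of_int (theta_phi_minus $ s\<^sup>2) * q ^ s\<^sup>2)
        = (\<Sum>s=1..n. 2 * ((- 1) ^ s * q ^ s\<^sup>2))"
      by (rule sum.cong) (auto simp: nth)
    finally show ?thesis by (simp add: sum_distrib_left)
  qed
  then show "(\<lambda>n. \<Sum>s<Suc n. of_int (theta_phi_minus $ s\<^sup>2) * q ^ s\<^sup>2)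
      \<longlonglongrightarrow> euler_prod q ^ 2 / euler_prod (q\<^sup>2)"
    using gauss_square[OF assms] by (simp only:)
qed (simp add: strict_mono_def)

section \<open>q-expansions and their uniqueness\<close>

lemma norm_to_q: "Im z > 0 \<Longrightarrow> norm (to_q z) < 1"
  by (simp add: to_q_def)

lemma to_q_surj:
  assumes "q \<noteq> 0" "norm q < 1"
  obtains z where "Im z > 0" "to_q z = q"
proof
  let ?z = "Ln q / (2 * complex_of_real pi * \<i>)"
  show "to_q ?z = q" using assms by (simp add: to_q_def)
  have "?z = Ln q * (- \<i> / (2 * complex_of_real pi))"
    by (simp add: field_simps)
  also have "Im \<dots> = - Re (Ln q) / (2 * pi)"
    by (simp add: complex_eq_iff Im_divide_of_real Im_complex_div_eq_0)
  finally show "Im ?z > 0" using assms by (simp add: divide_neg_pos)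
qed

text \<open>As z varies, q covers only the punctured disc, so the coefficients are recovered by
  induction: divide the difference by q^m and let q tend to 0.\<close>

lemma has_q_expansion_unique:
  assumes "has_q_expansion F t" "has_q_expansion F t'"
  shows "t = t'"
proof -
  define d where "d = (\<lambda>n. complex_of_int (t n) - of_int (t' n))"
  have sums: "(\<lambda>n. d n * q ^ n) sums 0" if "q \<noteq> 0" "norm q < 1" for q
  proof -
    obtain z where "Im z > 0" "to_q z = q" using to_q_surj[OF \<open>q \<noteq> 0\<close> \<open>norm q < 1\<close>] .
    then have "(\<lambda>n. of_int (t n) * q ^ n) sums F z" "(\<lambda>n. of_int (t' n) * q ^ n) sums F z"
      using assms by (auto simp: has_q_expansion_def)
    from sums_diff[OF this] show ?thesis by (simp add: d_def algebra_simps)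
  qed
  have "d m = 0" for m
  proof (induction m rule: less_induct)
    case (less m)
    have "(\<lambda>n. d (n + m) * q ^ n) sums 0" if "q \<noteq> 0" "norm q < 1" for q
    proof -
      have "(\<lambda>n. d (n + m) * q ^ (n + m)) sums (0 - (\<Sum>i<m. d i * q ^ i))"
        using sums_split_initial_segment[OF sums[OF that], of m] .
      then have "(\<lambda>n. (1 / q ^ m) * (d (n + m) * q ^ (n + m))) sums ((1 / q ^ m) * 0)"
        using less by (intro sums_mult) simp
      then show ?thesis using that by (simp add: power_add)
    qed
    then have "((\<lambda>q. 0) \<longlongrightarrow> d (0 + m)) (at (0::complex))"
      by (intro powser_limit_0_strong[of 1 "\<lambda>n. d (n + m)" "\<lambda>q. 0"]) auto
    then show ?case by (simp add: tendsto_const_iff)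
  qed
  then show ?thesis by (auto simp: d_def fun_eq_iff)
qed

lemma the_q_expansion_eqI:
  assumes "\<And>z. Im z > 0 \<Longrightarrow> evaluates f (to_q z) (F z)" "f $ 0 = 0"
  shows "(THE t. has_q_expansion F t) = (\<lambda>n. f $ n)"
proof (rule the_equality)
  show "has_q_expansion F (\<lambda>n. f $ n)"
    using assms by (auto simp: has_q_expansion_def evaluates_def)
  then show "t = (\<lambda>n. f $ n)" if "has_q_expansion F t" for t
    using has_q_expansion_unique that by blast
qed

text \<open>All fractional exponents are carried by powers of the one number exp(2 pi i z/24), so
  that in products of eta values only its exponents have to be added.\<close>

lemma dedekind_eta_mult:
  "dedekind_eta (of_nat k * z)
   = exp (2 * complex_of_real pi * \<i> * z / 24) ^ k * euler_prod (to_q z ^ k)"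
proof -
  have "to_q (of_nat k * z) = to_q z ^ k"
    unfolding to_q_def exp_of_nat_mult[symmetric] by (simp add: mult_ac)
  moreover have "exp (2 * complex_of_real pi * \<i> * (of_nat k * z) / 24)
      = exp (2 * complex_of_real pi * \<i> * z / 24) ^ k"
    unfolding exp_of_nat_mult[symmetric] by (simp add: mult_ac)
  ultimately show ?thesis by (simp add: dedekind_eta_def euler_prod_def)
qed

lemma to_q_eq_power: "to_q z = exp (2 * complex_of_real pi * \<i> * z / 24) ^ 24"
  unfolding to_q_def exp_of_nat_mult[symmetric] by (simp add: mult_ac)

lemma evaluates_theta_X:
  assumes "norm q < 1"
  shows "evaluates theta_X q (q * ((euler_prod (q ^ 4) ^ 2 / euler_prod (q ^ 2))
    * (euler_prod (q ^ 12) ^ 2 / euler_prod (q ^ 6))))"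
proof -
  have "evaluates theta_X q (q * ((euler_prod ((q ^ 2)\<^sup>2) ^ 2 / euler_prod (q ^ 2))
    * (euler_prod ((q ^ 6)\<^sup>2) ^ 2 / euler_prod (q ^ 6))))"
    unfolding theta_X_def
    by (intro evaluates_mult evaluates_fps_X evaluates_dilate evaluates_theta_psi
        norm_power_less_one assms zero_less_numeral)
  then show ?thesis by (simp flip: power_mult)
qed

lemma evaluates_dilate_theta_phi_minus:
  assumes "norm q < 1" "k > 0"
  shows "evaluates (dilate theta_phi_minus k) q (euler_prod (q ^ k) ^ 2 / euler_prod (q ^ (2 * k)))"
  using evaluates_dilate[OF assms(2) evaluates_theta_phi_minus[OF norm_power_less_one[OF assms]]]
  by (simp add: power_mult[symmetric] mult.commute)

text \<open>Write E_k for the Euler product at q^k. Gauss' formulas give X = q E_4^2 E_12^2/(E_2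
  E_6) and phi(-q^2) phi(-q^6) = E_2^2 E_6^2/(E_4 E_12), with product q E_2 E_4 E_6 E_12; the
  leading q matches since 2 + 4 + 6 + 12 = 24.\<close>

lemma tau_2_24_eq:
  "tau_2_24 = (\<lambda>n. (theta_X * (dilate theta_phi_minus 2 * dilate theta_phi_minus 6)) $ n)"
  unfolding tau_2_24_def
proof (rule the_q_expansion_eqI)
  show "(theta_X * (dilate theta_phi_minus 2 * dilate theta_phi_minus 6)) $ 0 = 0"
    by (simp add: theta_X_def)
  fix z :: complex assume z: "Im z > 0"
  define q where "q = to_q z"
  have q: "norm q < 1" using norm_to_q[OF z] by (simp add: q_def)
  define e where "e = exp (2 * complex_of_real pi * \<i> * z / 24)"
  have eta: "dedekind_eta (numeral k * z) = e ^ numeral k * euler_prod (q ^ numeral k)" for k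
    using dedekind_eta_mult[of "numeral k" z] by (simp add: e_def q_def)
  have ne: "euler_prod (q ^ numeral k) \<noteq> 0" for k
    using norm_power_less_one[OF q] by (intro euler_prod_nonzero) simp
  let ?v = "q * ((euler_prod (q ^ 4) ^ 2 / euler_prod (q ^ 2))
      * (euler_prod (q ^ 12) ^ 2 / euler_prod (q ^ 6)))
    * ((euler_prod (q ^ 2) ^ 2 / euler_prod (q ^ (2 * 2)))
        * (euler_prod (q ^ 6) ^ 2 / euler_prod (q ^ (2 * 6))))"
  have "evaluates (theta_X * (dilate theta_phi_minus 2 * dilate theta_phi_minus 6)) q ?v"
    by (intro evaluates_mult evaluates_theta_X evaluates_dilate_theta_phi_minus q zero_less_numeral)
  moreover have "?v = q * (euler_prod (q ^ 2) * euler_prod (q ^ 4) * euler_prod (q ^ 6)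
      * euler_prod (q ^ 12))"
    using ne[of "num.Bit0 num.One"] ne[of "num.Bit0 (num.Bit0 num.One)"] ne[of "num.Bit0
        (num.Bit1 num.One)"]
      ne[of "num.Bit0 (num.Bit0 (num.Bit1 num.One))"]
    by (simp add: divide_simps power2_eq_square)
  moreover have "\<dots> = dedekind_eta (2 * z) * dedekind_eta (4 * z) * dedekind_eta (6 * z)
      * dedekind_eta (12 * z)"
  proof -
    have "q = e ^ 2 * e ^ 4 * e ^ 6 * e ^ 12"
      by (simp add: q_def to_q_eq_power e_def flip: power_add)
    then have "q * (euler_prod (q ^ 2) * euler_prod (q ^ 4) * euler_prod (q ^ 6)
        * euler_prod (q ^ 12))
      = (e ^ 2 * e ^ 4 * e ^ 6 * e ^ 12) * (euler_prod (q ^ 2) * euler_prod (q ^ 4)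
          * euler_prod (q ^ 6) * euler_prod (q ^ 12))"
      by (rule arg_cong[of _ _ "\<lambda>c. c * _"])
    then show ?thesis unfolding eta by (simp only: mult_ac)
  qed
  ultimately show "evaluates (theta_X * (dilate theta_phi_minus 2
      * dilate theta_phi_minus 6)) (to_q z)
     (dedekind_eta (2 * z) * dedekind_eta (4 * z) * dedekind_eta (6 * z) * dedekind_eta (12 * z))"
    by (simp only: q_def)
qed

text \<open>With E_k the Euler product at q^k, now phi(-q^4) phi(-q^12) = E_4^2 E_12^2/(E_8 E_24),
  which multiplies the E_4^2 E_12^2/(E_2 E_6) from X.\<close>

lemma tau_2_48_eq:
  "tau_2_48 = (\<lambda>n. (theta_X * (dilate theta_phi_minus 4 * dilate theta_phi_minus 12)) $ n)"
  unfolding tau_2_48_def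
proof (rule the_q_expansion_eqI)
  show "(theta_X * (dilate theta_phi_minus 4 * dilate theta_phi_minus 12)) $ 0 = 0"
    by (simp add: theta_X_def)
  fix z :: complex assume z: "Im z > 0"
  define q where "q = to_q z"
  have q: "norm q < 1" using norm_to_q[OF z] by (simp add: q_def)
  define e where "e = exp (2 * complex_of_real pi * \<i> * z / 24)"
  have eta: "dedekind_eta (numeral k * z) = e ^ numeral k * euler_prod (q ^ numeral k)" for k
    using dedekind_eta_mult[of "numeral k" z] by (simp add: e_def q_def)
  let ?p = "\<lambda>k. euler_prod (q ^ k)"
  let ?v = "q * ((?p 4 ^ 2 / ?p 2) * (?p 12 ^ 2 / ?p 6)) * ((?p 4 ^ 2 / ?p (2 * 4))
      * (?p 12 ^ 2 / ?p (2 * 12)))"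
  have "evaluates (theta_X * (dilate theta_phi_minus 4 * dilate theta_phi_minus 12)) q ?v"
    by (intro evaluates_mult evaluates_theta_X evaluates_dilate_theta_phi_minus q zero_less_numeral)
  moreover have "?v = q * ((?p 4 ^ 4 * ?p 12 ^ 4) / (?p 2 * ?p 6 * ?p 8 * ?p 24))"
  proof -
    have "c * ((t ^ 2 / u) * (v ^ 2 / w)) * ((t ^ 2 / x) * (v ^ 2 / y))
        = c * ((t ^ 4 * v ^ 4) / (u * w * x * y))"
      for c t u v w x y :: complex
      by (simp add: divide_inverse power2_eq_square power4_eq_xxxx mult_ac)
    from this[of q "?p 4" "?p 2" "?p 12" "?p 6" "?p 8" "?p 24"] show ?thesis by simp
  qed
  moreover have "\<dots> = (dedekind_eta (4 * z) ^ 4 * dedekind_eta (12 * z) ^ 4)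
      / (dedekind_eta (2 * z) * dedekind_eta (6 * z) * dedekind_eta (8 * z)
          * dedekind_eta (24 * z))"
  proof -
    \<comment> \<open>Both exponents are 64: 24 + 2 + 6 + 8 + 24 and 16 + 48.\<close>
    have "q * (e ^ 2 * e ^ 6 * e ^ 8 * e ^ 24) = (e ^ 4) ^ 4 * (e ^ 12) ^ 4"
      by (simp add: q_def to_q_eq_power e_def flip: power_add power_mult)
    moreover have "e ^ 2 * e ^ 6 * e ^ 8 * e ^ 24 \<noteq> 0" by (simp add: e_def)
    ultimately have "q = ((e ^ 4) ^ 4 * (e ^ 12) ^ 4) / (e ^ 2 * e ^ 6 * e ^ 8 * e ^ 24)"
      by (simp only: nonzero_eq_divide_eq not_False_eq_True)
    then have "q * ((?p 4 ^ 4 * ?p 12 ^ 4) / (?p 2 * ?p 6 * ?p 8 * ?p 24))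
      = ((e ^ 4) ^ 4 * (e ^ 12) ^ 4) / (e ^ 2 * e ^ 6 * e ^ 8 * e ^ 24) * ((?p 4 ^ 4
          * ?p 12 ^ 4) / (?p 2 * ?p 6 * ?p 8 * ?p 24))"
      by (rule arg_cong[of _ _ "\<lambda>c. c * _"])
    also have "\<dots> = ((e ^ 4 * ?p 4) ^ 4 * (e ^ 12 * ?p 12) ^ 4)
      / ((e ^ 2 * ?p 2) * (e ^ 6 * ?p 6) * (e ^ 8 * ?p 8) * (e ^ 24 * ?p 24))"
      by (simp only: power_mult_distrib times_divide_times_eq mult_ac)
    finally show ?thesis unfolding eta .
  qed
  ultimately show "evaluates (theta_X * (dilate theta_phi_minus 4
      * dilate theta_phi_minus 12)) (to_q z)
     ((dedekind_eta (4 * z) ^ 4 * dedekind_eta (12 * z) ^ 4)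
      / (dedekind_eta (2 * z) * dedekind_eta (6 * z) * dedekind_eta (8 * z)
          * dedekind_eta (24 * z)))"
    by (simp only: q_def)
qed

section \<open>Comparison of coefficients and the four formulas\<close>

lemma divisor_sigma_eq:
  assumes "n > 0" "k > 0"
  shows "divisor_sigma (real n / real k) = real_of_int (dilate sigma_series k $ n)"
proof (cases "k dvd n")
  case True
  then obtain m where m: "n = k * m" by blast
  then have "real n / real k = real m" "m > 0" using assms by auto
  then show ?thesis
    using assms(2) by (auto simp: divisor_sigma_def dilate_nth m sigma_series_def
        divisor_series_def)
next
  case False
  have "real n / real k \<noteq> real m" for m
  proof
    assume "real n / real k = real m"
    then have "real n = real (m * k)" using assms by (simp add: field_simps)
    then have "n = m * k" by (simp only: of_nat_eq_iff)
    then show False using False by simp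
  qed
  then show ?thesis using False assms(2) by (auto simp: divisor_sigma_def dilate_nth)
qed

lemma N2_eq:
  assumes "k > 0"
  shows "int (N2 1 k n) = (borwein_a * dilate borwein_a k) $ n"
proof -
  have "borwein_a * dilate borwein_a k
      = count_series (UNIV \<times> UNIV) (\<lambda>(x, y). eisenstein_form x + int k * eisenstein_form y)"
    unfolding borwein_a_def dilate_count_series[OF assms]
    by (intro count_series_mult finite_fibres_scale finite_fibres_eisenstein_form assms)
  also have "\<dots> = count_series UNIV (\<lambda>(x\<^sub>1, x\<^sub>2, x\<^sub>3, x\<^sub>4).
      int 1 * (x\<^sub>1\<^sup>2 + x\<^sub>1 * x\<^sub>2 + x\<^sub>2\<^sup>2) + int k * (x\<^sub>3\<^sup>2 + x\<^sub>3 * x\<^sub>4 + x\<^sub>4\<^sup>2))"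
    by (rule count_series_bij[where h = "\<lambda>((a, b), c, d). (a, b, c, d)"
          and k = "\<lambda>(a, b, c, d). ((a, b), c, d)"]) (auto simp: eisenstein_form_def)
  finally show ?thesis
    by (simp add: count_series_def N2_def case_prod_unfold)
qed

text \<open>Expanding the square in \<open>lambert_a_relation\<close> isolates 2 a(q) a(q^4) =
  a(q)^2 - 3 a(q^2)^2 + 4 a(q^4)^2, and all squares are known.\<close>

lemma borwein_a_mult_dilate_4:
  "borwein_a * dilate borwein_a 4
   = 1 + 6 * sigma_series - 18 * dilate sigma_series 2 - 18 * dilate sigma_series 3
     + 24 * dilate sigma_series 4 + 54 * dilate sigma_series 6 - 72 * dilate sigma_series 12"
proof -
  let ?a = "dilate borwein_a" and ?S = "dilate sigma_series"
  have "2 * (borwein_a * ?a 4) = borwein_a * borwein_a - 3 * dilate (borwein_a * borwein_a) 2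
      + 4 * dilate (borwein_a * borwein_a) 4"
    using lambert_a_relation unfolding borwein_a_eq_lambert_a[symmetric]
    by (simp add: dilate_simps algebra_simps)
  also have "borwein_a * borwein_a = 1 + 12 * sigma_series - 36 * dilate sigma_series 3"
    unfolding borwein_a_eq_lambert_a by (rule lambert_a_square)
  also have "1 + 12 * sigma_series - 36 * ?S 3 - 3 * dilate (1 + 12 * sigma_series - 36 * ?S 3) 2
      + 4 * dilate (1 + 12 * sigma_series - 36 * ?S 3) 4
      = 2 * (1 + 6 * sigma_series - 18 * ?S 2 - 18 * ?S 3 + 24 * ?S 4 + 54 * ?S 6 - 72 * ?S 12)"
    by (simp add: dilate_simps algebra_simps)
  finally show ?thesis by (simp only: mult_cancel_left) simp
qed

text \<open>The factors are 6 X = a(q) - a(q^4) and 3 phi(-q^2) phi(-q^6) = 4 a(q^8) - a(q^2),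
  whence the 18. In the expansion only a(q) a(q^8) is new; the rest is a(q) a(q^2) and its
  dilations.\<close>

lemma tau_24_relation:
  "18 * (theta_X * (dilate theta_phi_minus 2 * dilate theta_phi_minus 6))
   = 4 * (borwein_a * dilate borwein_a 8) - borwein_a * dilate borwein_a 2
     - 4 * dilate (borwein_a * dilate borwein_a 2) 4 + dilate (borwein_a * dilate borwein_a 2) 2"
proof -
  let ?a = "dilate borwein_a"
  have X: "6 * theta_X = borwein_a - ?a 4"
    by (subst borwein_a_dissection(1)) simp
  have "6 * dilate theta_X 2 = ?a 2 - ?a 8"
    using arg_cong[OF X, of "\<lambda>f. dilate f 2"] by (simp add: dilate_simps)
  moreover have "dilate theta_phi_minus 2 * dilate theta_phi_minus 6 = ?a 8 - 2 * dilate theta_X 2"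
    using arg_cong[OF theta_phi_minus_mult, of "\<lambda>f. dilate f 2"] by (simp add: dilate_simps)
  ultimately have "3 * (dilate theta_phi_minus 2 * dilate theta_phi_minus 6)
      = 3 * ?a 8 - (?a 2 - ?a 8)"
    by simp
  then have "(6 * theta_X) * (3 * (dilate theta_phi_minus 2 * dilate theta_phi_minus 6))
      = (borwein_a - ?a 4) * (3 * ?a 8 - (?a 2 - ?a 8))" unfolding X by simp
  then show ?thesis by (simp add: dilate_simps algebra_simps)
qed

text \<open>Likewise with 3 phi(-q^4) phi(-q^12) = 4 a(q^16) - a(q^4); the new product is a(q)
  a(q^16).\<close>

lemma tau_48_relation:
  "18 * (theta_X * (dilate theta_phi_minus 4 * dilate theta_phi_minus 12))
   = 4 * (borwein_a * dilate borwein_a 16) - borwein_a * dilate borwein_a 4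
     - 4 * dilate (borwein_a * dilate borwein_a 4) 4 + dilate (borwein_a * borwein_a) 4"
proof -
  let ?a = "dilate borwein_a"
  have X: "6 * theta_X = borwein_a - ?a 4"
    by (subst borwein_a_dissection(1)) simp
  have "6 * dilate theta_X 4 = ?a 4 - ?a 16"
    using arg_cong[OF X, of "\<lambda>f. dilate f 4"] by (simp add: dilate_simps)
  moreover have "dilate theta_phi_minus 4 * dilate theta_phi_minus 12
      = ?a 16 - 2 * dilate theta_X 4"
    using arg_cong[OF theta_phi_minus_mult, of "\<lambda>f. dilate f 4"] by (simp add: dilate_simps)
  ultimately have "3 * (dilate theta_phi_minus 4 * dilate theta_phi_minus 12)
      = 3 * ?a 16 - (?a 4 - ?a 16)"
    by simp
  then have "(6 * theta_X) * (3 * (dilate theta_phi_minus 4 * dilate theta_phi_minus 12))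
      = (borwein_a - ?a 4) * (3 * ?a 16 - (?a 4 - ?a 16))" unfolding X by simp
  then show ?thesis by (simp add: dilate_simps algebra_simps)
qed

theorem theorem2p2:
  fixes n :: nat
  assumes "n > 0"
  shows "real (N2 1 2 n) =
           6 * divisor_sigma (real n) - 12 * divisor_sigma (real n / 2)
           + 18 * divisor_sigma (real n / 3) - 36 * divisor_sigma (real n / 6) \<and>
         real (N2 1 4 n) =
           6 * divisor_sigma (real n) - 18 * divisor_sigma (real n / 2)
           - 18 * divisor_sigma (real n / 3) + 24 * divisor_sigma (real n / 4)
           + 54 * divisor_sigma (real n / 6) - 72 * divisor_sigma (real n / 12) \<and>
         real (N2 1 8 n) =
           3/2 * divisor_sigma (real n) - 9/2 * divisor_sigma (real n / 2)
           + 9/2 * divisor_sigma (real n / 3) + 9 * divisor_sigma (real n / 4)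
           - 27/2 * divisor_sigma (real n / 6) - 12 * divisor_sigma (real n / 8)
           + 27 * divisor_sigma (real n / 12) - 36 * divisor_sigma (real n / 24)
           + 9/2 * real_of_int (tau_2_24 n) \<and>
         real (N2 1 16 n) =
           3/2 * divisor_sigma (real n) - 9/2 * divisor_sigma (real n / 2)
           - 9/2 * divisor_sigma (real n / 3) + 9 * divisor_sigma (real n / 4)
           + 27/2 * divisor_sigma (real n / 6) - 18 * divisor_sigma (real n / 8)
           - 27 * divisor_sigma (real n / 12) + 24 * divisor_sigma (real n / 16)
           + 54 * divisor_sigma (real n / 24) - 72 * divisor_sigma (real n / 48)
           + 9/2 * real_of_int (tau_2_48 n)"
proof -
  define s where "s = (\<lambda>k. dilate sigma_series k $ n)"
  let ?a = "dilate borwein_a" and ?S = "dilate sigma_series"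
  have sigma: "divisor_sigma (real n) = real_of_int (s 1)"
    "divisor_sigma (real n / numeral k) = real_of_int (s (numeral k))" for k
    using divisor_sigma_eq[OF assms, of 1] divisor_sigma_eq[OF assms, of "numeral k"]
    by (simp_all add: s_def)
  have N: "real (N2 1 (numeral k) n) = real_of_int ((borwein_a * ?a (numeral k)) $ n)" for k
    using N2_eq[of "numeral k" n] by (metis of_int_of_nat_eq zero_less_numeral)
  have one: "(1 :: int fps) $ n = 0" and S1: "sigma_series $ n = s 1"
    and S: "?S (numeral k) $ n = s (numeral k)" for k
    using assms by (simp_all add: s_def)
  note nth = fps_add_nth fps_sub_nth numeral_mult_fps_nth one S1 S
  have G: "borwein_a * ?a 2 = 1 + 6 * sigma_series - 12 * ?S 2 + 18 * ?S 3 - 36 * ?S 6"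
    unfolding borwein_a_eq_lambert_a by (rule lambert_a_mult_dilate_2)
  have E: "borwein_a * borwein_a = 1 + 12 * sigma_series - 36 * ?S 3"
    unfolding borwein_a_eq_lambert_a by (rule lambert_a_square)
  have c2: "(borwein_a * ?a 2) $ n = 6 * s 1 - 12 * s 2 + 18 * s 3 - 36 * s 6"
    unfolding G nth by simp
  have c4: "(borwein_a * ?a 4) $ n
      = 6 * s 1 - 18 * s 2 - 18 * s 3 + 24 * s 4 + 54 * s 6 - 72 * s 12"
    unfolding borwein_a_mult_dilate_4 nth by simp
  \<comment> \<open>To be solved for the coefficient of a(q) a(q^8): division by 4 turns the factor
    18 into 9/2.\<close>
  have t24: "18 * tau_2_24 n = 4 * (borwein_a * ?a 8) $ n
      - (6 * s 1 - 12 * s 2 + 18 * s 3 - 36 * s 6)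
      - 4 * (6 * s 4 - 12 * s 8 + 18 * s 12 - 36 * s 24)
      + (6 * s 2 - 12 * s 4 + 18 * s 6 - 36 * s 12)"
  proof -
    have "18 * tau_2_24 n
        = (18 * (theta_X * (dilate theta_phi_minus 2 * dilate theta_phi_minus 6))) $ n"
      by (simp add: tau_2_24_eq numeral_mult_fps_nth)
    also have "\<dots> = 4 * (borwein_a * ?a 8) $ n - (6 * s 1 - 12 * s 2 + 18 * s 3 - 36 * s 6)
      - 4 * (6 * s 4 - 12 * s 8 + 18 * s 12 - 36 * s 24)
      + (6 * s 2 - 12 * s 4 + 18 * s 6 - 36 * s 12)"
      unfolding tau_24_relation G by (use assms in \<open>simp add: dilate_simps nth fps_numeral_nth\<close>)
    finally show ?thesis .
  qed
  have t48: "18 * tau_2_48 n = 4 * (borwein_a * ?a 16) $ n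
      - (6 * s 1 - 18 * s 2 - 18 * s 3 + 24 * s 4 + 54 * s 6 - 72 * s 12)
      - 4 * (6 * s 4 - 18 * s 8 - 18 * s 12 + 24 * s 16 + 54 * s 24 - 72 * s 48)
      + (12 * s 4 - 36 * s 12)"
  proof -
    have "18 * tau_2_48 n
        = (18 * (theta_X * (dilate theta_phi_minus 4 * dilate theta_phi_minus 12))) $ n"
      by (simp add: tau_2_48_eq numeral_mult_fps_nth)
    also have "\<dots> = 4 * (borwein_a * ?a 16) $ n
      - (6 * s 1 - 18 * s 2 - 18 * s 3 + 24 * s 4 + 54 * s 6 - 72 * s 12)
      - 4 * (6 * s 4 - 18 * s 8 - 18 * s 12 + 24 * s 16 + 54 * s 24 - 72 * s 48)
      + (12 * s 4 - 36 * s 12)"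
      unfolding tau_48_relation borwein_a_mult_dilate_4 E
      by (use assms in \<open>simp add: dilate_simps nth fps_numeral_nth\<close>)
    finally show ?thesis .
  qed
  note real = c2 c4 t24 t48
  note real = real[THEN arg_cong[where f = real_of_int], unfolded of_int_add of_int_diff of_int_mult
      of_int_numeral]
  show ?thesis
    using real unfolding sigma N by (intro conjI) (simp_all add: field_simps)
qed

end
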